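(* Let $m,n\ge 2$ be integers, let $G_{m,n}$ be the $m\times n$ grid graph, and let $k\in\{2,3\}$. Then there is a homotopy equivalence $$\|\mathsf{Cliq}_k(G_{m,n})\|\;\simeq\;\bigvee_{\binom{(m-1)(n-1)}{k-1}} S^{2k-3},$$ i.e. the geometric realization of the $k$-robust clique complex of $G_{m,n}$ is homotopy equivalent to a wedge of $\binom{(m-1)(n-1)}{k-1}$ copies of the sphere $S^{2k-3}$.
   Context: Graphs are finite and simple. The grid graph $G_{m,n}$ has vertex set $\{(i,j)\mid 1\le i\le m,\ 1\le j\le n\}$ and edges $\{(i,j),(i,j+1)\}$ for $1\le i\le m$, $1\le j\le n-1$, and $\{(i,j),(i+1,j)\}$ for $1\le i\le m-1$, $1\le j\le n$. For a graph $G$ and an integer $k\ge 2$, the $k$-robust clique complex $\mathsf{Cliq}_k(G)$ is the simplicial complex on vertex set $V(G)$ whose simplices are exactly the subsets $W\subseteq V(G)$ that do not contain an independent set of $G$ of size $k$. $\|K\|$ denotes the geometric realization of a simplicial complex $K$. A wedge of zero spheres is a point. *)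

theory Defs
  imports "HOL-Analysis.Analysis"
begin

section \<open>Graphs\<close>

text \<open>A graph is a pair of a vertex set and a set of edges, each edge being a two-element
  set of vertices.\<close>

type_synonym 'a graph = "'a set \<times> 'a set set"

definition finite_simple_graph :: "'a graph \<Rightarrow> bool" where
  "finite_simple_graph G \<longleftrightarrow> finite (fst G) \<and> (\<forall>e \<in> snd G. e \<subseteq> fst G \<and> card e = 2)"

definition grid_graph :: "nat \<Rightarrow> nat \<Rightarrow> (nat \<times> nat) graph" where
  "grid_graph m n =
    ({1..m} \<times> {1..n},
     {{(i, j), (i, j + 1)} | i j. 1 \<le> i \<and> i \<le> m \<and> 1 \<le> j \<and> j \<le> n - 1} \<union>
     {{(i, j), (i + 1, j)} | i j. 1 \<le> i \<and> i \<le> m - 1 \<and> 1 \<le> j \<and> j \<le> n})"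

lemma finite_simple_graph_grid_graph: "finite_simple_graph (grid_graph m n)"
  by (auto simp: finite_simple_graph_def grid_graph_def)

definition independent_set :: "'a graph \<Rightarrow> 'a set \<Rightarrow> bool" where
  "independent_set G S \<longleftrightarrow> S \<subseteq> fst G \<and> (\<forall>u \<in> S. \<forall>v \<in> S. {u, v} \<notin> snd G)"

section \<open>Simplicial complexes\<close>

text \<open>An abstract simplicial complex is given by its set of simplices. The empty simplex is
  allowed; it contributes no point to the geometric realization.\<close>

definition abstract_simplicial_complex :: "'a set \<Rightarrow> 'a set set \<Rightarrow> bool" where
  "abstract_simplicial_complex V K \<longleftrightarrow>
    (\<forall>\<sigma> \<in> K. finite \<sigma> \<and> \<sigma> \<subseteq> V) \<and> (\<forall>v \<in> V. {v} \<in> K) \<and> (\<forall>\<sigma> \<in> K. \<forall>\<tau>. \<tau> \<subseteq> \<sigma> \<longrightarrow> \<tau> \<in> K)"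

definition robust_clique_complex :: "nat \<Rightarrow> 'a graph \<Rightarrow> 'a set set" where
  "robust_clique_complex k G =
    {W. W \<subseteq> fst G \<and> \<not> (\<exists>S. S \<subseteq> W \<and> independent_set G S \<and> card S = k)}"

lemma abstract_simplicial_complex_robust_clique_complex:
  assumes "finite_simple_graph G" and "k \<ge> 2"
  shows "abstract_simplicial_complex (fst G) (robust_clique_complex k G)"
proof -
  have "{v} \<in> robust_clique_complex k G" if v: "v \<in> fst G" for v
  proof -
    have "card S \<noteq> k" if "S \<subseteq> {v}" for S
      using card_mono[OF _ that] assms(2) by simp
    with v show ?thesis
      unfolding robust_clique_complex_def by blast
  qed
  moreover have "finite \<sigma> \<and> \<sigma> \<subseteq> fst G" if "\<sigma> \<in> robust_clique_complex k G" for \<sigma>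
  proof -
    have "\<sigma> \<subseteq> fst G"
      using that by (simp add: robust_clique_complex_def)
    moreover have "finite (fst G)"
      using assms(1) by (simp add: finite_simple_graph_def)
    ultimately show ?thesis
      by (simp add: finite_subset)
  qed
  moreover have "\<tau> \<in> robust_clique_complex k G"
    if "\<sigma> \<in> robust_clique_complex k G" "\<tau> \<subseteq> \<sigma>" for \<sigma> \<tau>
    using that unfolding robust_clique_complex_def by blast
  ultimately show ?thesis
    unfolding abstract_simplicial_complex_def by blast
qed

text \<open>The points of the realization are given by their barycentric coordinates, i.e. by formal
  convex combinations of vertices whose support is a simplex. They carry the topology of
  pointwise convergence, which is the usual topology of the realization when there are only
  finitely many vertices.\<close>

definition geometric_realization :: "'a set set \<Rightarrow> ('a \<Rightarrow> real) topology" where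
  "geometric_realization K =
    subtopology (powertop_real UNIV)
      {x. (\<forall>v. 0 \<le> x v) \<and> {v. x v \<noteq> 0} \<in> K \<and> sum x {v. x v \<noteq> 0} = 1}"

section \<open>Wedge sums\<close>

text \<open>The wedge of the pointed spaces \<open>(X i, b i)\<close> is the quotient of their disjoint union that
  identifies all base points: \<open>None\<close> is the common base point, and \<open>Some (i, x)\<close> is the
  point \<open>x \<noteq> b i\<close> of the \<open>i\<close>-th summand. The base point is present even if there are no
  summands, so that the empty wedge is a point.\<close>

definition wedge_proj :: "('i \<Rightarrow> 'a) \<Rightarrow> 'i \<times> 'a \<Rightarrow> ('i \<times> 'a) option" where
  "wedge_proj b = (\<lambda>(i, x). if x = b i then None else Some (i, x))"

definition wedge_sum :: "'i set \<Rightarrow> ('i \<Rightarrow> 'a topology) \<Rightarrow> ('i \<Rightarrow> 'a) \<Rightarrow> ('i \<times> 'a) option topology" where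
  "wedge_sum I X b =
    topology (\<lambda>U. U \<subseteq> insert None (wedge_proj b ` topspace (sum_topology X I)) \<and>
      openin (sum_topology X I) {p \<in> topspace (sum_topology X I). wedge_proj b p \<in> U})"

lemma openin_wedge_sum:
  "openin (wedge_sum I X b) U \<longleftrightarrow>
    U \<subseteq> insert None (wedge_proj b ` topspace (sum_topology X I)) \<and>
    openin (sum_topology X I) {p \<in> topspace (sum_topology X I). wedge_proj b p \<in> U}"
proof -
  let ?T = "topspace (sum_topology X I)"
  let ?P = "\<lambda>U. U \<subseteq> insert None (wedge_proj b ` ?T) \<and>
    openin (sum_topology X I) {p \<in> ?T. wedge_proj b p \<in> U}"
  have 1: "{p \<in> ?T. wedge_proj b p \<in> U \<inter> V}
      = {p \<in> ?T. wedge_proj b p \<in> U} \<inter> {p \<in> ?T. wedge_proj b p \<in> V}" for U V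
    by blast
  have 2: "{p \<in> ?T. wedge_proj b p \<in> \<Union>\<K>} = (\<Union>U\<in>\<K>. {p \<in> ?T. wedge_proj b p \<in> U})" for \<K>
    by blast
  have "istopology ?P"
    unfolding istopology_def
  proof (intro conjI allI impI)
    fix U V assume "?P U" "?P V"
    then show "U \<inter> V \<subseteq> insert None (wedge_proj b ` ?T)"
      and "openin (sum_topology X I) {p \<in> ?T. wedge_proj b p \<in> U \<inter> V}"
      unfolding 1 by (blast, intro openin_Int) simp_all
  next
    fix \<K> assume K: "\<forall>U\<in>\<K>. ?P U"
    then show "\<Union>\<K> \<subseteq> insert None (wedge_proj b ` ?T)"
      by blast
    show "openin (sum_topology X I) {p \<in> ?T. wedge_proj b p \<in> \<Union>\<K>}"
      unfolding 2 using K by (intro openin_Union) blast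
  qed
  then show ?thesis
    unfolding wedge_sum_def by (simp only: topology_inverse')
qed

lemma topspace_wedge_sum:
  "topspace (wedge_sum I X b) = insert None (wedge_proj b ` topspace (sum_topology X I))"
proof (rule antisym)
  show "topspace (wedge_sum I X b) \<subseteq> insert None (wedge_proj b ` topspace (sum_topology X I))"
    using openin_topspace[of "wedge_sum I X b"] unfolding openin_wedge_sum by blast
  have eq: "{p \<in> topspace (sum_topology X I).
      wedge_proj b p \<in> insert None (wedge_proj b ` topspace (sum_topology X I))}
      = topspace (sum_topology X I)"
    by blast
  have "openin (wedge_sum I X b) (insert None (wedge_proj b ` topspace (sum_topology X I)))"
    unfolding openin_wedge_sum eq by (meson openin_topspace order_refl)
  then show "insert None (wedge_proj b ` topspace (sum_topology X I)) \<subseteq> topspace (wedge_sum I X b)"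
    by (rule openin_subset)
qed

lemma quotient_map_wedge_proj:
  assumes "I \<noteq> {}" and "\<And>i. i \<in> I \<Longrightarrow> b i \<in> topspace (X i)"
  shows "quotient_map (sum_topology X I) (wedge_sum I X b) (wedge_proj b)"
proof -
  obtain i where "i \<in> I"
    using assms(1) by blast
  then have "None = wedge_proj b (i, b i)" "(i, b i) \<in> topspace (sum_topology X I)"
    using assms(2) by (auto simp: wedge_proj_def)
  then have "topspace (wedge_sum I X b) = wedge_proj b ` topspace (sum_topology X I)"
    unfolding topspace_wedge_sum by blast
  then show ?thesis
    unfolding quotient_map_def openin_wedge_sum by blast
qed

definition wedge_of_spheres :: "nat \<Rightarrow> nat \<Rightarrow> (nat \<times> (nat \<Rightarrow> real)) option topology" where
  "wedge_of_spheres N d = wedge_sum {..<N} (\<lambda>_. nsphere d) (\<lambda>_ i. if i = 0 then 1 else 0)"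

lemma topspace_wedge_of_spheres_0: "topspace (wedge_of_spheres 0 d) = {None}"
  by (simp add: wedge_of_spheres_def topspace_wedge_sum)

end

theory Submission
  imports Defs
begin

text \<open>
  In a bipartite graph a vertex set contains no independent \<open>k\<close>-set iff it is covered by
  \<open>k - 1\<close> edges or vertices, so for \<open>k = 2\<close> the complex is the grid itself, and for \<open>k = 3\<close> its
  simplices are the subsets of unions of two edges, of dimension at most \<open>3\<close>.  It suffices to find
  a contractible subcomplex \<open>L\<close> such that all remaining simplices have dimension \<open>2 k - 3\<close>: then
  \<open>K \<simeq> K / L\<close>, which is a wedge of spheres, one for each simplex outside \<open>L\<close>.

  For \<open>k = 2\<close> take a spanning tree.  For \<open>k = 3\<close> build the grid vertex by vertex.  If the new vertex
  \<open>v\<close> closes a square \<open>v u x w\<close> over the graph \<open>G\<close> built so far, its link is the union of the cones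
  over \<open>G\<close> with apexes \<open>u\<close> and \<open>w\<close>.  Replacing the second cone by the cone over a spanning tree \<open>T\<close>
  that contains all edges at \<open>w\<close> and the edge \<open>u x\<close> makes the link contractible; this discards the
  tetrahedra \<open>{v, w} \<union> e\<close> for the edges \<open>e\<close> outside \<open>T\<close>, one for each square of \<open>G\<close>.  Summing over
  all \<open>N\<close> squares gives \<open>0 + 1 + \<dots> + (N - 1) = N choose 2\<close> spheres.

  Contractibility and homotopy extension come from the theory of absolute (neighbourhood) retracts,
  after embedding the realization into a Euclidean space of dimension \<open>8\<close> by the moment curve.
\<close>

section \<open>Realizations in Euclidean space\<close>

text \<open>All simplices outside \<open>L\<close> have the same number of vertices, so their proper
  faces lie in \<open>L\<close>. The quotient by \<open>L\<close> is therefore a wedge of spheres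
  whatever the attaching maps are, and no homology is computed. For \<open>k = 3\<close> the
  obstacle is that the whole link of a new vertex cannot be kept: the two full cones meet in a
  complex that contains the graph with all its cycles. Thinning one cone to a spanning tree breaks
  exactly these cycles, at the price of one triangle of the link per independent cycle. Absolute
  retracts fit this plan twice. Closed absolute retracts that meet in an absolute retract have an
  absolute retract as union, which is the topological counterpart of gluing complexes. Maps into a
  neighbourhood retract extend to neighbourhoods, which yields homotopy extension without cell
  structures. Both facts concern subsets of Euclidean space, hence the embedding.\<close>

lemma moment_curve_independent:
  fixes t :: "'a \<Rightarrow> real" and idx :: "'n::finite \<Rightarrow> nat"
  assumes idx: "bij_betw idx UNIV {..<CARD('n)}" and S: "finite S" "card S \<le> CARD('n)"
    and inj: "inj_on t S" and eq: "(\<Sum>v\<in>S. c v *\<^sub>R ((\<chi> i. t v ^ idx i) :: real^'n)) = 0" and w: "w \<in> S"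
  shows "c w = 0"
proof -
  have pow: "(\<Sum>v\<in>S. c v * t v ^ j) = 0" if "j < CARD('n)" for j
  proof -
    obtain i where i: "idx i = j"
      using idx \<open>j < CARD('n)\<close> unfolding bij_betw_def by (metis imageE lessThan_iff)
    have "(\<Sum>v\<in>S. c v *\<^sub>R ((\<chi> i. t v ^ idx i) :: real^'n)) $ i = 0"
      using eq by simp
    then show ?thesis by (simp add: i)
  qed
  \<comment> \<open>The Lagrange polynomial of the node \<open>t w\<close>: its degree
    \<open>card S - 1\<close> lies below the dimension, so pairing \<open>c\<close> with it is a
    combination of the vanishing power sums, and among the nodes only \<open>t w\<close>
    survives.\<close>
  define P where "P = (\<Prod>u\<in>S-{w}. [:- t u, 1:])"
  have "degree P = (\<Sum>u\<in>S-{w}. degree [:- t u, 1:])"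
    unfolding P_def by (rule degree_prod_eq_sum_degree) auto
  then have deg: "degree P < CARD('n)"
    using S w card_Diff1_less[of S w] by simp
  have "(\<Sum>v\<in>S. c v * poly P (t v)) = (\<Sum>v\<in>S. \<Sum>j\<le>degree P. coeff P j * (c v * t v ^ j))"
    by (simp add: poly_altdef sum_distrib_left mult_ac)
  also have "\<dots> = (\<Sum>j\<le>degree P. coeff P j * (\<Sum>v\<in>S. c v * t v ^ j))"
    by (subst sum.swap) (simp add: sum_distrib_left)
  also have "\<dots> = 0"
    using pow deg by (intro sum.neutral) auto
  finally have 0: "(\<Sum>v\<in>S. c v * poly P (t v)) = 0" .
  have "poly P (t v) = 0" if "v \<in> S" "v \<noteq> w" for v
    using that S(1) by (auto simp: P_def poly_prod)
  then have "(\<Sum>v\<in>S. c v * poly P (t v)) = c w * poly P (t w)"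
    using S(1) w by (subst sum.remove[of S w]) (auto intro!: sum.neutral)
  moreover have "poly P (t w) \<noteq> 0"
    using S(1) w inj by (auto simp: P_def poly_prod inj_on_def)
  ultimately show ?thesis using 0 by simp
qed

lemma exists_general_position:
  fixes V :: "'a set"
  assumes "finite V"
  obtains p :: "'a \<Rightarrow> real^'n::finite" where
    "\<And>S c. S \<subseteq> V \<Longrightarrow> card S \<le> CARD('n) \<Longrightarrow> (\<Sum>v\<in>S. c v *\<^sub>R p v) = 0 \<Longrightarrow> (\<forall>v\<in>S. c v = 0)"
proof -
  obtain idx :: "'n \<Rightarrow> nat" where "bij_betw idx UNIV {..<CARD('n)}"
    using ex_bij_betw_finite_nat[of "UNIV :: 'n set"] by (auto simp: atLeast0LessThan)
  moreover obtain h :: "'a \<Rightarrow> nat" where h: "inj_on h V"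
    using assms finite_imp_inj_to_nat_seg by blast
  moreover have "inj_on (\<lambda>v. real (h v)) S" if "S \<subseteq> V" for S
    using h that by (auto simp: inj_on_def)
  ultimately show ?thesis
    by (intro that[of "\<lambda>v. \<chi> i. real (h v) ^ idx i"] ballI moment_curve_independent)
       (auto intro: finite_subset[OF _ assms])
qed

section \<open>Closed simplices in barycentric coordinates\<close>

definition simplicial :: "'a set \<Rightarrow> nat \<Rightarrow> 'a set set \<Rightarrow> bool" where
  "simplicial V r A \<longleftrightarrow> (\<forall>\<sigma>\<in>A. \<sigma> \<subseteq> V \<and> card \<sigma> \<le> r) \<and> (\<forall>\<sigma>\<in>A. \<forall>\<tau>. \<tau> \<subseteq> \<sigma> \<longrightarrow> \<tau> \<in> A)"

lemma simplicial_Un: "simplicial V r A \<Longrightarrow> simplicial V r B \<Longrightarrow> simplicial V r (A \<union> B)"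
  unfolding simplicial_def by (simp add: ball_Un)

lemma simplicial_Int: "simplicial V r A \<Longrightarrow> simplicial V r B \<Longrightarrow> simplicial V r (A \<inter> B)"
  unfolding simplicial_def by (metis IntD1 IntD2 IntI)

text \<open>Coordinates on \<sigma> may vanish, so this is the closed simplex, which is compact and
  convex; \<open>geometric_realization\<close> is described by exact supports, that is, by open
  simplices.\<close>

definition face :: "'a set \<Rightarrow> ('a \<Rightarrow> real) set" where
  "face \<sigma> = {x. (\<forall>v. 0 \<le> x v) \<and> (\<forall>v. v \<notin> \<sigma> \<longrightarrow> x v = 0) \<and> sum x \<sigma> = 1}"

lemma faceD: "x \<in> face \<sigma> \<Longrightarrow> 0 \<le> x v" "x \<in> face \<sigma> \<Longrightarrow> v \<notin> \<sigma> \<Longrightarrow> x v = 0" "x \<in> face \<sigma> \<Longrightarrow> sum x \<sigma> = 1"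
  by (auto simp: face_def)

lemma face_mono: "finite \<tau> \<Longrightarrow> \<sigma> \<subseteq> \<tau> \<Longrightarrow> face \<sigma> \<subseteq> face \<tau>"
proof
  fix x assume "finite \<tau>" "\<sigma> \<subseteq> \<tau>" and x: "x \<in> face \<sigma>"
  then have "sum x \<sigma> = sum x \<tau>"
    by (intro sum.mono_neutral_left) (auto simp: face_def)
  with x \<open>\<sigma> \<subseteq> \<tau>\<close> show "x \<in> face \<tau>" by (auto simp: face_def)
qed

lemma vertex_in_face: "finite \<sigma> \<Longrightarrow> v \<in> \<sigma> \<Longrightarrow> (\<lambda>u. if u = v then 1 else 0) \<in> face \<sigma>"
  by (auto simp: face_def)

lemma face_convex_comb:
  assumes "x \<in> face \<sigma>" "y \<in> face \<sigma>" "0 \<le> u" "0 \<le> w" "u + w = (1::real)"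
  shows "(\<lambda>v. u * x v + w * y v) \<in> face \<sigma>"
  using assms by (auto simp: face_def sum.distrib simp flip: sum_distrib_left)

text \<open>The support of a point of a closed simplex is a subset of it, so closure under subsets
  allows open simplices to be traded for closed ones.\<close>

lemma topspace_geometric_realization:
  assumes "simplicial V r A" "finite V"
  shows "topspace (geometric_realization A) = (\<Union>\<sigma>\<in>A. face \<sigma>)"
proof (rule set_eqI)
  fix x :: "'a \<Rightarrow> real"
  have fin: "finite \<sigma>" if "\<sigma> \<in> A" for \<sigma>
    using that assms by (meson finite_subset simplicial_def)
  show "x \<in> topspace (geometric_realization A) \<longleftrightarrow> x \<in> (\<Union>\<sigma>\<in>A. face \<sigma>)"
  proof
    assume "x \<in> topspace (geometric_realization A)"
    then have "{v. x v \<noteq> 0} \<in> A \<and> x \<in> face {v. x v \<noteq> 0}"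
      by (auto simp: geometric_realization_def face_def)
    then show "x \<in> (\<Union>\<sigma>\<in>A. face \<sigma>)" by blast
  next
    assume "x \<in> (\<Union>\<sigma>\<in>A. face \<sigma>)"
    then obtain \<sigma> where s: "\<sigma> \<in> A" "x \<in> face \<sigma>" by blast
    then have "{v. x v \<noteq> 0} \<subseteq> \<sigma>" by (auto simp: face_def)
    moreover from this have "sum x {v. x v \<noteq> 0} = sum x \<sigma>"
      using fin[OF s(1)] by (intro sum.mono_neutral_left) auto
    ultimately show "x \<in> topspace (geometric_realization A)"
      using s assms(1) by (auto simp: geometric_realization_def simplicial_def face_def)
  qed
qed

lemma compactin_face:
  assumes "finite \<sigma>"
  shows "compactin (powertop_real UNIV) (face \<sigma>)"
proof -
  \<comment> \<open>By Tychonoff this product is compact; the condition on the coordinate sum cuts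
    out a closed subset of it.\<close>
  let ?B = "PiE UNIV (\<lambda>v. if v \<in> \<sigma> then {0..1::real} else {0})"
  have eq: "face \<sigma> = ?B \<inter> {x \<in> topspace (powertop_real UNIV). sum x \<sigma> \<in> {1}}"
  proof (intro set_eqI iffI)
    fix x assume x: "x \<in> face \<sigma>"
    have "x v \<le> 1" if "v \<in> \<sigma>" for v
      using x member_le_sum[of v \<sigma> x] that assms by (auto simp: face_def)
    with x show "x \<in> ?B \<inter> {x \<in> topspace (powertop_real UNIV). sum x \<sigma> \<in> {1}}"
      by (auto simp: face_def PiE_iff)
  next
    fix x assume "x \<in> ?B \<inter> {x \<in> topspace (powertop_real UNIV). sum x \<sigma> \<in> {1}}"
    then have x: "\<And>v. x v \<in> (if v \<in> \<sigma> then {0..1::real} else {0})" "sum x \<sigma> = 1"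
      by (auto simp: PiE_iff)
    have "0 \<le> x v \<and> (v \<notin> \<sigma> \<longrightarrow> x v = 0)" for v
      using x(1)[of v] by (cases "v \<in> \<sigma>") auto
    then show "x \<in> face \<sigma>" using x(2) by (auto simp: face_def)
  qed
  have "continuous_map (powertop_real UNIV) euclideanreal (\<lambda>x. sum x \<sigma>)"
    by (intro continuous_map_sum assms continuous_map_product_projection) auto
  then have "closedin (powertop_real UNIV) {x \<in> topspace (powertop_real UNIV). sum x \<sigma> \<in> {1}}"
    by (rule closedin_continuous_map_preimage) auto
  moreover have "compactin (powertop_real UNIV) ?B"
    by (subst compactin_PiE) auto
  ultimately show ?thesis unfolding eq by (simp add: compact_Int_closedin)
qed

text \<open>The bound \<open>2 * r\<close> makes two simplices with at most \<open>r\<close> vertices each meet only in their common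
  face.\<close>

locale general_position =
  fixes V :: "'a set" and r :: nat and p :: "'a \<Rightarrow> 'b::euclidean_space"
  assumes finV: "finite V"
    and indep: "\<lbrakk>S \<subseteq> V; card S \<le> 2 * r; (\<Sum>v\<in>S. c v *\<^sub>R p v) = 0; v \<in> S\<rbrakk> \<Longrightarrow> c v = 0"
begin

definition bary :: "('a \<Rightarrow> real) \<Rightarrow> 'b" where "bary x = (\<Sum>v\<in>V. x v *\<^sub>R p v)"

definition polyhedron_of :: "'a set set \<Rightarrow> 'b set" where
  "polyhedron_of A = bary ` (\<Union>\<sigma>\<in>A. face \<sigma>)"

lemma continuous_bary: "continuous_map (powertop_real UNIV) euclidean bary"
proof -
  have "continuous_map (powertop_real UNIV) euclidean (\<lambda>x. x v *\<^sub>R p v)" for v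
    using continuous_map_compose[OF continuous_map_product_projection[of v UNIV "\<lambda>_. euclideanreal"],
        of euclidean "\<lambda>c. c *\<^sub>R p v"]
    by (simp add: o_def continuous_on_scaleR)
  then show ?thesis
    unfolding bary_def by (intro continuous_map_sum finV)
qed

lemma bary_inj:
  assumes A: "simplicial V r A" and x: "x \<in> (\<Union>\<sigma>\<in>A. face \<sigma>)" and y: "y \<in> (\<Union>\<sigma>\<in>A. face \<sigma>)"
    and eq: "bary x = bary y"
  shows "x = y"
proof -
  obtain \<sigma> \<tau> where s: "\<sigma> \<in> A" "x \<in> face \<sigma>" "\<tau> \<in> A" "y \<in> face \<tau>" using x y by blast
  then have "\<sigma> \<subseteq> V" "\<tau> \<subseteq> V" "card \<sigma> \<le> r" "card \<tau> \<le> r"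
    using A unfolding simplicial_def by auto
  then have sub: "\<sigma> \<union> \<tau> \<subseteq> V" and card: "card (\<sigma> \<union> \<tau>) \<le> 2 * r"
    using card_Un_le[of \<sigma> \<tau>] by auto
  have 0: "x v = 0 \<and> y v = 0" if "v \<notin> \<sigma> \<union> \<tau>" for v using that s by (auto simp: face_def)
  \<comment> \<open>Two points with the same image yield a linear relation among at most
    \<open>2 * r\<close> vertices, so all its coefficients vanish.\<close>
  have "(\<Sum>v\<in>\<sigma> \<union> \<tau>. (x v - y v) *\<^sub>R p v) = (\<Sum>v\<in>V. (x v - y v) *\<^sub>R p v)"
    using 0 sub finV by (intro sum.mono_neutral_left) auto
  also have "\<dots> = 0" using eq by (simp add: bary_def scaleR_diff_left sum_subtractf)
  finally have "x v - y v = 0" if "v \<in> \<sigma> \<union> \<tau>" for v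
    using indep[OF sub card, of "\<lambda>v. x v - y v" v] that by blast
  then show ?thesis using 0 by (metis eq_iff_diff_eq_0 ext)
qed

lemma finite_simplicial: "simplicial V r A \<Longrightarrow> finite A"
  unfolding simplicial_def using finite_subset[of A "Pow V"] finV by blast

lemma finite_simplex: "simplicial V r A \<Longrightarrow> \<sigma> \<in> A \<Longrightarrow> finite \<sigma>"
  by (rule finite_subset[OF _ finV]) (simp add: simplicial_def)

lemma face_Int:
  assumes "finite \<sigma>" "finite \<tau>" "x \<in> face \<sigma>" "x \<in> face \<tau>"
  shows "x \<in> face (\<sigma> \<inter> \<tau>)"
proof -
  have "sum x (\<sigma> \<inter> \<tau>) = sum x \<sigma>"
    using assms by (intro sum.mono_neutral_left) (auto simp: face_def)
  then show ?thesis using assms by (auto simp: face_def)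
qed

lemma polyhedron_of_Un: "polyhedron_of (A \<union> B) = polyhedron_of A \<union> polyhedron_of B"
  by (auto simp: polyhedron_of_def)

text \<open>Injectivity on \<open>A \<union> B\<close> gives a common point the same coordinates in
  both complexes, so it lies in the face spanned by the common vertices. Gluing retracts requires
  the intersection of the polyhedra in this combinatorial form.\<close>

lemma polyhedron_of_Int:
  assumes A: "simplicial V r A" and B: "simplicial V r B"
  shows "polyhedron_of (A \<inter> B) = polyhedron_of A \<inter> polyhedron_of B"
proof
  show "polyhedron_of (A \<inter> B) \<subseteq> polyhedron_of A \<inter> polyhedron_of B"
    by (auto simp: polyhedron_of_def)
  show "polyhedron_of A \<inter> polyhedron_of B \<subseteq> polyhedron_of (A \<inter> B)"
  proof
    fix z assume "z \<in> polyhedron_of A \<inter> polyhedron_of B"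
    then obtain x y \<sigma> \<tau> where xy: "z = bary x" "\<sigma> \<in> A" "x \<in> face \<sigma>" "z = bary y" "\<tau> \<in> B" "y \<in> face \<tau>"
      unfolding polyhedron_of_def by blast
    then have "x = y"
      using bary_inj[OF simplicial_Un[OF A B]] by blast
    with xy have "x \<in> face (\<sigma> \<inter> \<tau>)"
      using face_Int[OF finite_simplex[OF A] finite_simplex[OF B]] by blast
    moreover have "\<sigma> \<inter> \<tau> \<in> A \<inter> B"
      using A B xy by (auto simp: simplicial_def)
    ultimately show "z \<in> polyhedron_of (A \<inter> B)"
      unfolding polyhedron_of_def xy(1) by blast
  qed
qed

lemma compact_bary_face: "finite \<sigma> \<Longrightarrow> compact (bary ` face \<sigma>)"
  using image_compactin[OF compactin_face continuous_bary] by simp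

lemma convex_bary_face: "convex (bary ` face \<sigma>)"
proof (rule convexI)
  fix a b and u w :: real
  assume "a \<in> bary ` face \<sigma>" "b \<in> bary ` face \<sigma>" and uw: "0 \<le> u" "0 \<le> w" "u + w = 1"
  then obtain x y where xy: "a = bary x" "x \<in> face \<sigma>" "b = bary y" "y \<in> face \<sigma>" by blast
  have "u *\<^sub>R a + w *\<^sub>R b = bary (\<lambda>v. u * x v + w * y v)"
    by (simp add: xy bary_def scaleR_sum_right sum.distrib scaleR_left_distrib)
  then show "u *\<^sub>R a + w *\<^sub>R b \<in> bary ` face \<sigma>"
    using face_convex_comb[OF xy(2,4) uw] by blast
qed

lemma polyhedron_of_eq: "polyhedron_of A = (\<Union>\<sigma>\<in>A. bary ` face \<sigma>)"
  by (auto simp: polyhedron_of_def)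

lemma compact_polyhedron_of: "simplicial V r A \<Longrightarrow> compact (polyhedron_of A)"
  unfolding polyhedron_of_eq
  by (rule compact_UN[OF finite_simplicial]) (simp_all add: compact_bary_face finite_simplex)

lemma ANR_polyhedron_of:
  assumes "simplicial V r A"
  shows "ANR (polyhedron_of A)"
  unfolding polyhedron_of_eq
proof (rule ANR_finite_Union_convex_closed)
  show "finite ((\<lambda>\<sigma>. bary ` face \<sigma>) ` A)"
    using finite_simplicial[OF assms] by simp
next
  fix C assume "C \<in> (\<lambda>\<sigma>. bary ` face \<sigma>) ` A"
  then obtain \<sigma> where "\<sigma> \<in> A" "C = bary ` face \<sigma>" by blast
  then show "closed C" "convex C"
    using compact_bary_face[OF finite_simplex[OF assms]] convex_bary_face compact_imp_closed by auto
qed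

text \<open>The polyhedron is starlike about the vertex \<open>v\<close>, hence contractible, and a
  contractible neighbourhood retract is an absolute retract.\<close>

lemma AR_cone:
  assumes A: "simplicial V r A" and ne: "A \<noteq> {}" and cone: "\<And>\<sigma>. \<sigma> \<in> A \<Longrightarrow> insert v \<sigma> \<in> A"
  shows "AR (polyhedron_of A)"
proof -
  let ?e = "\<lambda>u. if u = v then 1 else (0::real)"
  obtain \<sigma>0 where s0: "\<sigma>0 \<in> A" using ne by blast
  have e: "bary ?e \<in> bary ` face (insert v \<sigma>)" if "\<sigma> \<in> A" for \<sigma>
    using vertex_in_face[of "insert v \<sigma>" v] finite_simplex[OF A cone[OF that]] by auto
  have "closed_segment (bary ?e) z \<subseteq> polyhedron_of A" if "z \<in> polyhedron_of A" for z
  proof -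
    obtain \<sigma> where s: "\<sigma> \<in> A" "z \<in> bary ` face \<sigma>"
      using \<open>z \<in> polyhedron_of A\<close> unfolding polyhedron_of_eq by blast
    then have "z \<in> bary ` face (insert v \<sigma>)"
      using face_mono[OF finite_simplex[OF A cone[OF s(1)]] subset_insertI] by blast
    then have "closed_segment (bary ?e) z \<subseteq> bary ` face (insert v \<sigma>)"
      using e[OF s(1)] convex_bary_face by (simp add: closed_segment_subset)
    then show ?thesis using cone[OF s(1)] by (auto simp: polyhedron_of_eq)
  qed
  moreover have "bary ?e \<in> polyhedron_of A" using e[OF s0] cone[OF s0] by (auto simp: polyhedron_of_eq)
  ultimately have "starlike (polyhedron_of A)" "polyhedron_of A \<noteq> {}"
    unfolding starlike_def by blast+
  then show ?thesis
    using ANR_polyhedron_of[OF A] AR_ANR starlike_imp_contractible by blast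
qed

end

text \<open>A combinatorial certificate of contractibility, which keeps topology out of the later
  constructions. Asking for a certificate of the intersection as well makes the rule
  \<open>glue\<close> match the union theorem for closed absolute retracts.\<close>

inductive cone_glued :: "'a set \<Rightarrow> nat \<Rightarrow> 'a set set \<Rightarrow> bool" for V r where
  cone: "\<lbrakk>simplicial V r A; A \<noteq> {}; \<And>\<sigma>. \<sigma> \<in> A \<Longrightarrow> insert v \<sigma> \<in> A\<rbrakk> \<Longrightarrow> cone_glued V r A"
| glue: "\<lbrakk>cone_glued V r A; cone_glued V r B; cone_glued V r (A \<inter> B)\<rbrakk> \<Longrightarrow> cone_glued V r (A \<union> B)"

lemma cone_glued_simplicial: "cone_glued V r A \<Longrightarrow> simplicial V r A"
  by (induction rule: cone_glued.induct) (auto intro: simplicial_Un)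

lemma (in general_position) AR_cone_glued:
  "cone_glued V r A \<Longrightarrow> AR (polyhedron_of A)"
proof (induction rule: cone_glued.induct)
  case (cone A v)
  then show ?case by (rule AR_cone)
next
  case (glue A B)
  then show ?case
    using cone_glued_simplicial[of V r]
    by (auto simp: polyhedron_of_Un polyhedron_of_Int intro!: AR_closed_Un compact_imp_closed compact_polyhedron_of)
qed

text \<open>A continuous bijection from a compact space onto a Hausdorff space. It carries
  homotopies of the polyhedron back to the realization.\<close>

lemma (in general_position) homeomorphic_map_bary:
  assumes A: "simplicial V r A"
  shows "homeomorphic_map (geometric_realization A) (top_of_set (polyhedron_of A)) bary"
proof -
  note ts = topspace_geometric_realization[OF A finV]
  have sub: "geometric_realization A = subtopology (powertop_real UNIV) (\<Union>\<sigma>\<in>A. face \<sigma>)"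
    using ts unfolding geometric_realization_def by simp
  have "compactin (powertop_real UNIV) (\<Union>\<sigma>\<in>A. face \<sigma>)"
    by (intro compactin_Union[of "face ` A", simplified])
       (auto simp: finite_simplicial[OF A] intro: compactin_face finite_simplex[OF A])
  then have "compact_space (geometric_realization A)"
    unfolding sub using compact_space_subtopology by blast
  moreover have "continuous_map (geometric_realization A) (top_of_set (polyhedron_of A)) bary"
    unfolding sub by (auto simp: continuous_map_in_subtopology polyhedron_of_def
        intro!: continuous_map_from_subtopology continuous_bary)
  moreover have "inj_on bary (\<Union>\<sigma>\<in>A. face \<sigma>)"
    using bary_inj[OF A] by (auto simp: inj_on_def)
  ultimately show ?thesis
    unfolding ts[symmetric]
    by (intro continuous_imp_homeomorphic_map)
       (auto simp: ts polyhedron_of_def Hausdorff_space_subtopology)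
qed

section \<open>Collapsing a contractible subspace\<close>

text \<open>Homotopy extension: the contraction of \<open>L\<close>, joined with the identity of
  \<open>K\<close> at time 0, extends over a neighbourhood because \<open>K\<close> is a
  neighbourhood retract; time is then slowed down so that the homotopy never leaves that
  neighbourhood.\<close>

lemma AR_contraction_extension:
  fixes K L :: "'b::euclidean_space set"
  assumes K: "compact K" "ANR K" and L: "closed L" "L \<subseteq> K" "AR L"
  obtains H :: "real \<times> 'b \<Rightarrow> 'b" and a where "continuous_on ({0..1} \<times> K) H" "H \<in> {0..1} \<times> K \<rightarrow> K"
    "\<And>x. x \<in> K \<Longrightarrow> H (0, x) = x" "\<And>t x. t \<in> {0..1} \<Longrightarrow> x \<in> L \<Longrightarrow> H (t, x) \<in> L"
    "\<And>x. x \<in> L \<Longrightarrow> H (1, x) = a"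
proof -
  have "contractible L" using L(3) AR_imp_contractible by blast
  then obtain a h where h: "continuous_on ({0..1::real} \<times> L) h" "h \<in> {0..1} \<times> L \<rightarrow> L"
      "\<And>x. h (0, x) = x" "\<And>x. h (1, x) = a"
    unfolding contractible_def homotopic_with_def by auto
  define B where "B = {0::real} \<times> K \<union> {0..1} \<times> L"
  define \<Phi> where "\<Phi> = (\<lambda>z. if z \<in> {0..1} \<times> L then h z else snd z)"
  have clB: "closed ({0::real} \<times> K)" "closed ({0..1::real} \<times> L)"
    by (intro closed_Times compact_imp_closed[OF K(1)] L(1); simp)+
  have "continuous_on B (\<lambda>z. if z \<in> {0..1} \<times> L then h z else snd z)"
    unfolding B_def Un_commute[of "{0} \<times> K"]
    by (rule continuous_on_cases[OF clB(2,1) h(1)]) (auto intro: continuous_on_snd simp: h)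
  then have cont: "continuous_on B \<Phi>" unfolding \<Phi>_def .
  have hL: "h (t, x) \<in> L" if "0 \<le> t" "t \<le> 1" "x \<in> L" for t x
    using h(2) that by (simp add: Pi_iff)
  then have im: "\<Phi> \<in> B \<rightarrow> K" using L(2) by (auto simp: \<Phi>_def B_def subset_iff)
  have "closedin (top_of_set ({0..1} \<times> K)) B"
    using clB L(2) by (intro closed_subset) (auto simp: B_def)
  then obtain W g where W: "B \<subseteq> W" "openin (top_of_set ({0..1} \<times> K)) W" "continuous_on W g"
      "g \<in> W \<rightarrow> K" "\<And>z. z \<in> B \<Longrightarrow> g z = \<Phi> z"
    using ANR_imp_absolute_neighbourhood_extensor[OF K(2) cont im] by metis
  \<comment> \<open>The points whose time interval is not contained in \<open>W\<close>. Compactness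
    makes this set closed, and it misses \<open>L\<close>, so a Urysohn function \<alpha> exists:
    the time \<open>t * \<alpha> x\<close> freezes these points at 0 and runs at full speed on
    \<open>L\<close>.\<close>
  define S where "S = snd ` ({0..1} \<times> K - W)"
  have "closedin (top_of_set ({0..1} \<times> K)) ({0..1} \<times> K - W)"
    using W(2) by (simp add: closedin_diff)
  then have "compact ({0..1} \<times> K - W)"
    by (rule closedin_compact[OF compact_Times[OF compact_Icc K(1)]])
  then have "compact S" unfolding S_def by (intro compact_continuous_image continuous_intros)
  moreover have SK: "S \<subseteq> K" by (auto simp: S_def)
  ultimately have cloS: "closedin (top_of_set K) S" "closedin (top_of_set K) L"
    using L by (auto intro: closed_subset compact_imp_closed)
  moreover have "L \<inter> S = {}" using W(1) by (auto simp: S_def B_def)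
  ultimately obtain \<alpha> :: "'b \<Rightarrow> real" where \<alpha>: "continuous_on K \<alpha>" "\<And>x. x \<in> K \<Longrightarrow> \<alpha> x \<in> closed_segment 1 0"
      "\<And>x. x \<in> L \<Longrightarrow> \<alpha> x = 1" "\<And>x. x \<in> S \<Longrightarrow> \<alpha> x = 0"
    using Urysohn_local[of K L S 1 0] by metis
  have \<alpha>01: "0 \<le> \<alpha> x \<and> \<alpha> x \<le> 1" if "x \<in> K" for x
    using \<alpha>(2)[OF that] by (auto simp: closed_segment_eq_real_ivl)
  have inW: "(t * \<alpha> x, x) \<in> W" if "t \<in> {0..1}" "x \<in> K" for t x
  proof (cases "x \<in> S")
    case True
    then show ?thesis using \<alpha>(4) W(1) that by (auto simp: B_def)
  next
    case False
    have "(t * \<alpha> x, x) \<in> {0..1} \<times> K" using \<alpha>01[OF that(2)] that by (auto intro: mult_le_one)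
    with False show ?thesis unfolding S_def by force
  qed
  show ?thesis
  proof (rule that[of "\<lambda>z. g (fst z * \<alpha> (snd z), snd z)" a])
    show "continuous_on ({0..1} \<times> K) (\<lambda>z. g (fst z * \<alpha> (snd z), snd z))"
      by (intro continuous_on_compose2[OF W(3)] continuous_intros continuous_on_compose2[OF \<alpha>(1)])
         (auto simp: inW)
    show "(\<lambda>z. g (fst z * \<alpha> (snd z), snd z)) \<in> {0..1} \<times> K \<rightarrow> K"
      using inW W(4) by auto
    show "g (fst (0, x) * \<alpha> (snd (0, x)), snd (0, x)) = x" if "x \<in> K" for x
      using that W(5)[of "(0, x)"] by (auto simp: B_def \<Phi>_def h)
    show "g (fst (t, x) * \<alpha> (snd (t, x)), snd (t, x)) \<in> L" if "t \<in> {0..1}" "x \<in> L" for t x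
      using that W(5)[of "(t, x)"] \<alpha>(3) hL by (auto simp: B_def \<Phi>_def)
    show "g (fst (1, x) * \<alpha> (snd (1, x)), snd (1, x)) = a" if "x \<in> L" for x
      using that W(5)[of "(1, x)"] \<alpha>(3) by (auto simp: B_def \<Phi>_def h)
  qed
qed

text \<open>The homotopy inverse of \<open>q\<close> is induced by the final stage of
  \<open>H\<close>, which is constant on \<open>C\<close>. As \<open>H\<close> keeps
  \<open>C\<close> inside itself, \<open>H\<close> followed by \<open>q\<close> also descends to the
  quotient.\<close>

lemma homotopy_equivalent_collapse:
  assumes q: "quotient_map X W q" and C: "C \<subseteq> topspace X"
    and qC: "\<And>x y. x \<in> C \<Longrightarrow> y \<in> C \<Longrightarrow> q x = q y"
    and inj: "\<And>x y. x \<in> topspace X \<Longrightarrow> y \<in> topspace X \<Longrightarrow> q x = q y \<Longrightarrow> x = y \<or> x \<in> C \<and> y \<in> C"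
    and H: "continuous_map (prod_topology (top_of_set {0..1}) X) X H"
    and H0: "\<And>x. x \<in> topspace X \<Longrightarrow> H (0, x) = x"
    and HC: "\<And>t x. t \<in> {0..1} \<Longrightarrow> x \<in> C \<Longrightarrow> H (t, x) \<in> C"
    and H1: "\<And>x. x \<in> C \<Longrightarrow> H (1::real, x) = a"
  shows "X homotopy_equivalent_space W"
proof -
  let ?I = "top_of_set {0..1::real}"
  have surj: "q ` topspace X = topspace W" using q by (rule quotient_imp_surjective_map)
  have cq: "continuous_map X W q" using q by (rule quotient_imp_continuous_map)
  define s where "s w = (SOME x. x \<in> topspace X \<and> q x = w)" for w
  have s: "s w \<in> topspace X" "q (s w) = w" if "w \<in> topspace W" for w
  proof -
    have "\<exists>x. x \<in> topspace X \<and> q x = w" using that unfolding surj[symmetric] by auto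
    from someI_ex[OF this] show "s w \<in> topspace X" "q (s w) = w" unfolding s_def by simp_all
  qed
  have sq: "s (q x) = x \<or> s (q x) \<in> C \<and> x \<in> C" if "x \<in> topspace X" for x
  proof -
    have "q x \<in> topspace W" using that unfolding surj[symmetric] by simp
    from s[OF this] show ?thesis using inj[of "s (q x)" x] that by simp
  qed
  define g where "g w = H (1, s w)" for w
  have gq: "H (1, x) = (g \<circ> q) x" if "x \<in> topspace X" for x
    using sq[OF that] H1 by (auto simp: g_def)
  have "continuous_map X (prod_topology ?I X) (\<lambda>x. (1, x))"
    by (intro continuous_map_pairedI) auto
  then have "continuous_map X X (\<lambda>x. H (1, x))"
    using continuous_map_compose[OF _ H] by (simp add: o_def)
  then have cgq: "continuous_map X X (g \<circ> q)"
    by (rule continuous_map_eq) (use gq in auto)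
  then have cg: "continuous_map W X g" using continuous_compose_quotient_map[OF q] by blast
  define G where "G = (\<lambda>(t, w). q (H (t, s w)))"
  \<comment> \<open>The unit interval is locally compact and Hausdorff, so its product with a
    quotient map is again a quotient map; this makes the descended homotopy jointly
    continuous.\<close>
  have qp: "quotient_map (prod_topology ?I X) (prod_topology ?I W) (\<lambda>(t, x). (t, q x))"
    by (rule quotient_map_prod_right[OF _ _ q])
       (auto intro: Hausdorff_space_subtopology compact_imp_locally_compact_space simp: compact_space_subtopology)
  have "q (H z) = (G \<circ> (\<lambda>(t, x). (t, q x))) z" if z: "z \<in> topspace (prod_topology ?I X)" for z
  proof -
    obtain t x where z': "z = (t, x)" "t \<in> {0..1}" "x \<in> topspace X" using z by auto
    then show ?thesis using sq[OF z'(3)] qC[OF HC HC] by (auto simp: G_def)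
  qed
  moreover have "continuous_map (prod_topology ?I X) W (\<lambda>z. q (H z))"
    using continuous_map_compose[OF H cq] by (simp add: o_def)
  ultimately have "continuous_map (prod_topology ?I X) W (G \<circ> (\<lambda>(t, x). (t, q x)))"
    by (meson continuous_map_eq)
  then have "continuous_map (prod_topology ?I W) W G"
    using continuous_compose_quotient_map[OF qp] by blast
  then have "homotopic_with (\<lambda>x. True) W W id (q \<circ> g)"
    using s H0 by (subst homotopic_with) (auto simp: G_def g_def intro!: exI[of _ G])
  moreover have "homotopic_with (\<lambda>x. True) X X id (g \<circ> q)"
    using gq H0 H by (subst homotopic_with) (auto intro!: exI[of _ H])
  ultimately show ?thesis
    unfolding homotopy_equivalent_space_def
    by (intro exI[of _ q] exI[of _ g] conjI cq cg) (simp_all add: homotopic_with_sym)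
qed

section \<open>Simplices modulo their boundary\<close>

lemma continuous_map_Min:
  assumes "finite S" "S \<noteq> {}" "\<And>j. j \<in> S \<Longrightarrow> continuous_map X euclideanreal (f j)"
  shows "continuous_map X euclideanreal (\<lambda>x. Min ((\<lambda>j. f j x) ` S))"
  using assms
proof (induction S rule: finite_ne_induct)
  case (singleton j)
  then show ?case by simp
next
  case (insert j S)
  then show ?case by (simp add: continuous_map_real_min)
qed

text \<open>With \<open>m = min x\<close>, this is the inverse stereographic projection of the point with coordinates
  \<open>(x i - x 0) / m\<close>, multiplied out so that the boundary \<open>m = 0\<close> goes to the base point.\<close>

definition simplex_to_sphere :: "nat \<Rightarrow> (nat \<Rightarrow> real) \<Rightarrow> nat \<Rightarrow> real" where
  "simplex_to_sphere d x =
    (let m = Min (x ` {..d}); s = (\<Sum>j\<le>d. (x j - x 0)\<^sup>2)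
     in (\<lambda>i. if i = 0 then (s - m\<^sup>2) / (s + m\<^sup>2)
            else if i \<le> d then 2 * m * (x i - x 0) / (s + m\<^sup>2) else 0))"

lemma face_min:
  fixes x :: "nat \<Rightarrow> real"
  assumes "x \<in> face {..d}"
  shows "0 \<le> Min (x ` {..d})" "Min (x ` {..d}) = 0 \<longleftrightarrow> (\<exists>j\<le>d. x j = 0)"
proof -
  show ge: "0 \<le> Min (x ` {..d})" by (subst Min_ge_iff) (auto intro: faceD(1)[OF assms])
  have "Min (x ` {..d}) \<in> x ` {..d}" by (rule Min_in) auto
  moreover have "Min (x ` {..d}) \<le> x j" if "j \<le> d" for j using that by simp
  ultimately show "Min (x ` {..d}) = 0 \<longleftrightarrow> (\<exists>j\<le>d. x j = 0)"
    using ge by (smt (verit) atMost_iff imageE)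
qed

text \<open>If both terms vanish, all coordinates are equal and one of them is 0, so they cannot sum
  to 1.\<close>

lemma simplex_to_sphere_denominator:
  fixes x :: "nat \<Rightarrow> real"
  assumes "x \<in> face {..d}"
  shows "0 < (\<Sum>j\<le>d. (x j - x 0)\<^sup>2) + (Min (x ` {..d}))\<^sup>2"
proof (rule ccontr)
  let ?s = "\<Sum>j\<le>d. (x j - x 0)\<^sup>2" and ?m = "Min (x ` {..d})"
  assume "\<not> 0 < ?s + ?m\<^sup>2"
  moreover have "0 \<le> ?s" by (intro sum_nonneg) auto
  ultimately have "?s = 0" "?m = 0" using zero_le_power2[of ?m] by (smt (verit) zero_eq_power2)+
  have "\<forall>j\<in>{..d}. (x j - x 0)\<^sup>2 = 0"
    using \<open>?s = 0\<close> by (rule iffD1[OF sum_nonneg_eq_0_iff, rotated 2]) simp_all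
  from bspec[OF this] have sq: "(x j - x 0)\<^sup>2 = 0" if "j \<le> d" for j
    using that by (simp only: atMost_iff)
  have eq': "x j = x 0" if "j \<le> d" for j using sq[OF that] by (simp only: power_eq_0_iff right_minus_eq)
  obtain j where "j \<le> d" "x j = 0" using face_min(2)[OF assms] \<open>?m = 0\<close> by blast
  then have "x 0 = 0" using eq'[of j] by simp
  then have "sum x {..d} = 0" using eq' by (intro sum.neutral ballI) (metis atMost_iff)
  then show False using faceD(3)[OF assms] by simp
qed

lemma simplex_to_sphere_in_nsphere:
  assumes x: "x \<in> face {..d}"
  shows "simplex_to_sphere d x \<in> topspace (nsphere d)"
proof -
  define m where "m = Min (x ` {..d})"
  define s where "s = (\<Sum>j\<le>d. (x j - x 0)\<^sup>2)"
  have pos: "0 < s + m\<^sup>2" using simplex_to_sphere_denominator[OF x] by (simp add: s_def m_def)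
  have f: "simplex_to_sphere d x = (\<lambda>i. if i = 0 then (s - m\<^sup>2) / (s + m\<^sup>2)
            else if i \<le> d then 2 * m * (x i - x 0) / (s + m\<^sup>2) else 0)"
    unfolding simplex_to_sphere_def s_def m_def Let_def ..
  define F where "F = (simplex_to_sphere d x 0)\<^sup>2"
  \<comment> \<open>The second summand vanishes for \<open>i = 0\<close>, so one formula covers all
    coordinates and the sum splits.\<close>
  have "(simplex_to_sphere d x i)\<^sup>2 = (if i = 0 then F else 0)
      + (2 * m / (s + m\<^sup>2))\<^sup>2 * (x i - x 0)\<^sup>2" if "i \<le> d" for i
    using that by (auto simp: F_def f power_mult_distrib power_divide)
  then have "(\<Sum>i\<le>d. (simplex_to_sphere d x i)\<^sup>2)
      = F + (2 * m / (s + m\<^sup>2))\<^sup>2 * s"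
    by (simp add: sum.distrib s_def sum_distrib_left)
  also have "F + (2 * m / (s + m\<^sup>2))\<^sup>2 * s = 
     ((s - m\<^sup>2)\<^sup>2 + 4 * m\<^sup>2 * s) / (s + m\<^sup>2)\<^sup>2"
    by (simp add: F_def f power_divide power_mult_distrib add_divide_distrib)
  also have "(s - m\<^sup>2)\<^sup>2 + 4 * m\<^sup>2 * s = (s + m\<^sup>2)\<^sup>2" by (simp add: power2_eq_square algebra_simps)
  finally show ?thesis using pos by (simp add: nsphere f)
qed

text \<open>Coordinate 0 is 1 only if the minimum is 0, and a vanishing minimum makes all other
  coordinates vanish.\<close>

lemma simplex_to_sphere_eq_base:
  assumes x: "x \<in> face {..d}"
  shows "simplex_to_sphere d x = (\<lambda>i. if i = 0 then 1 else 0) \<longleftrightarrow> (\<exists>j\<le>d. x j = 0)"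
proof -
  define m where "m = Min (x ` {..d})"
  define s where "s = (\<Sum>j\<le>d. (x j - x 0)\<^sup>2)"
  have pos: "0 < s + m\<^sup>2" using simplex_to_sphere_denominator[OF x] by (simp add: s_def m_def)
  have f: "simplex_to_sphere d x = (\<lambda>i. if i = 0 then (s - m\<^sup>2) / (s + m\<^sup>2)
            else if i \<le> d then 2 * m * (x i - x 0) / (s + m\<^sup>2) else 0)"
    unfolding simplex_to_sphere_def s_def m_def Let_def ..
  have "simplex_to_sphere d x = (\<lambda>i. if i = 0 then 1 else 0) \<longleftrightarrow> m = 0"
  proof
    assume "simplex_to_sphere d x = (\<lambda>i. if i = 0 then 1 else 0)"
    then have "simplex_to_sphere d x 0 = 1" by simp
    then have "s - m\<^sup>2 = s + m\<^sup>2" using pos by (simp add: f)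
    then show "m = 0" by simp
  next
    assume "m = 0"
    then show "simplex_to_sphere d x = (\<lambda>i. if i = 0 then 1 else 0)" using pos by (auto simp: f)
  qed
  then show ?thesis using face_min(2)[OF x] by (simp add: m_def)
qed

text \<open>Divided by their minima, the two points have equal coordinate differences on
  \<open>{..d}\<close>, so there they differ by a constant. Both then have minimum 1, which forces
  the constant to be 0. Hence the points are proportional, and the coordinate sum 1 makes them
  equal.\<close>

lemma simplex_to_sphere_inj:
  assumes x: "x \<in> face {..d}" "\<forall>j\<le>d. x j \<noteq> 0" and y: "y \<in> face {..d}" "\<forall>j\<le>d. y j \<noteq> 0"
    and eq: "simplex_to_sphere d x = simplex_to_sphere d y"
  shows "x = y"
proof -
  define c where "c = (\<lambda>x::nat\<Rightarrow>real. (\<Sum>j\<le>d. (x j - x 0)\<^sup>2) + (Min (x ` {..d}))\<^sup>2)"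
  define m where "m = (\<lambda>x::nat\<Rightarrow>real. Min (x ` {..d}))"
  have cpos: "0 < c x" "0 < c y" unfolding c_def by (rule simplex_to_sphere_denominator, fact)+
  have mpos: "0 < m x" "0 < m y"
    using face_min[OF x(1)] face_min[OF y(1)] x y unfolding m_def by (metis order_le_less)+
  have 0: "simplex_to_sphere d z 0 = 1 - 2 * (m z)\<^sup>2 / c z" if "0 < c z" for z
    using that by (simp add: simplex_to_sphere_def Let_def c_def m_def field_simps)
  have i: "simplex_to_sphere d z i = 2 * m z * (z i - z 0) / c z" if "i \<noteq> 0" "i \<le> d" for z i
    using that by (simp add: simplex_to_sphere_def Let_def c_def m_def)
  have ratio: "(m x)\<^sup>2 / c x = (m y)\<^sup>2 / c y"
    using 0[OF cpos(1)] 0[OF cpos(2)] eq by simp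
  have u: "m x * (y j - y 0) = m y * (x j - x 0)" if "j \<le> d" for j
  proof (cases "j = 0")
    case False
    have "m x * (x j - x 0) / c x = m y * (y j - y 0) / c y"
      using i[OF False that, of x] i[OF False that, of y] eq by simp
    then have A: "m x * (x j - x 0) * c y = m y * (y j - y 0) * c x"
      using cpos by (simp add: field_simps)
    have B: "(m x)\<^sup>2 * c y = (m y)\<^sup>2 * c x" using ratio cpos by (simp add: field_simps)
    \<comment> \<open>The claim multiplied by the positive factor \<open>c x * m y * m y\<close>,
      which avoids division.\<close>
    have "c x * (m y * m y * (m x * (y j - y 0))) = m x * m y * (m y * (y j - y 0) * c x)"
      by (simp add: algebra_simps)
    also have "\<dots> = m y * (x j - x 0) * ((m x)\<^sup>2 * c y)"
      unfolding A[symmetric] by (simp add: power2_eq_square algebra_simps)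
    also have "\<dots> = c x * (m y * m y * (m y * (x j - x 0)))"
      unfolding B by (simp add: power2_eq_square algebra_simps)
    finally show ?thesis using cpos mpos by simp
  qed simp
  have le: "m z \<le> z j" if "j \<le> d" for z j using that by (simp add: m_def)
  have ex: "\<exists>j\<le>d. z j = m z" for z
    using Min_in[of "z ` {..d}"] by (fastforce simp: m_def)
  \<comment> \<open>Comparing at an index where \<open>x\<close> is minimal, and then at one where
    \<open>y\<close> is minimal, bounds the constant from both sides.\<close>
  obtain j where j: "j \<le> d" "x j = m x" using ex by blast
  have "m x * m y \<le> m x * y j" using le[OF j(1)] mpos by simp
  then have ge: "m y * x 0 \<le> m x * y 0" using u[OF j(1)] j(2) by (simp add: algebra_simps)
  obtain k where k: "k \<le> d" "y k = m y" using ex by blast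
  have "m y * m x \<le> m y * x k" using le[OF k(1)] mpos by simp
  then have "m x * y 0 \<le> m y * x 0" using u[OF k(1)] k(2) by (simp add: algebra_simps)
  with ge have proportional: "m x * y j = m y * x j" if "j \<le> d" for j using u[OF that] by (simp add: algebra_simps)
  have "m x * sum y {..d} = m y * sum x {..d}" using proportional by (simp add: sum_distrib_left)
  then have "m x = m y" by (simp only: faceD(3)[OF x(1)] faceD(3)[OF y(1)] mult_1_right)
  then have "x j = y j" if "j \<le> d" for j using proportional[OF that] mpos by simp
  moreover have "x j = y j" if "\<not> j \<le> d" for j using faceD(2)[OF x(1)] faceD(2)[OF y(1)] that by simp
  ultimately show ?thesis by blast
qed

lemma simplex_to_sphere_surj:
  assumes "1 \<le> d"
  shows "simplex_to_sphere d ` face {..d} = topspace (nsphere d)"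
proof
  show "simplex_to_sphere d ` face {..d} \<subseteq> topspace (nsphere d)"
    using simplex_to_sphere_in_nsphere by blast
  show "topspace (nsphere d) \<subseteq> simplex_to_sphere d ` face {..d}"
  proof
    fix y assume "y \<in> topspace (nsphere d)"
    then have y: "(\<Sum>i\<le>d. (y i)\<^sup>2) = 1" "\<And>i. i > d \<Longrightarrow> y i = 0" by (auto simp: nsphere)
    have split: "(\<Sum>i\<in>{..d}-{0}. (y i)\<^sup>2) = 1 - (y 0)\<^sup>2"
      using y(1) by (simp add: sum_diff1)
    show "y \<in> simplex_to_sphere d ` face {..d}"
    proof (cases "y 0 = 1")
      case True
      then have "(\<Sum>i\<in>{..d}-{0}. (y i)\<^sup>2) = 0" using split by simp
      then have "\<forall>i\<in>{..d}-{0}. y i = 0" by (subst (asm) sum_nonneg_eq_0_iff) simp_all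
      then have "y i = 0" if "i \<noteq> 0" for i using y(2)[of i] that by (cases "i \<le> d") simp_all
      then have yb: "y = (\<lambda>i. if i = 0 then 1 else 0)" using True by auto
      \<comment> \<open>The base point comes from the boundary, and a vertex lies there because
        \<open>1 \<le> d\<close> leaves another coordinate equal to 0.\<close>
      let ?e = "\<lambda>u::nat. if u = 0 then 1 else (0::real)"
      have e: "?e \<in> face {..d}" by (rule vertex_in_face) auto
      have "simplex_to_sphere d ?e = y"
        unfolding yb simplex_to_sphere_eq_base[OF e] using assms by auto
      then show ?thesis using e by blast
    next
      case False
      have "(y 0)\<^sup>2 \<le> 1" using split sum_nonneg[of "{..d}-{0}" "\<lambda>i. (y i)\<^sup>2"] by simp
      then have "y 0 \<le> 1" by (simp add: abs_square_le_1)
      with False have lt: "y 0 < 1" by simp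
      define a where "a = 1 - y 0"
      have a: "0 < a" using lt by (simp add: a_def)
      \<comment> \<open>The stereographic projection of \<open>y\<close> from the base point. The
        entry at 0 is 0 because \<open>u i\<close> is to become \<open>x i - x 0\<close> divided by
        the minimum.\<close>
      define u where "u i = (if i = 0 then 0 else y i / a)" for i
      define \<mu> where "\<mu> = Min (u ` {..d})"
      \<comment> \<open>The shift makes the minimum 1 without changing differences; division by the
        sum \<open>Z\<close> then gives a point of the simplex with minimum
        \<open>1 / Z\<close>.\<close>
      define z where "z i = (if i \<le> d then 1 - \<mu> + u i else 0)" for i
      have \<mu>: "\<mu> \<le> u i" if "i \<le> d" for i using that by (simp add: \<mu>_def)
      have z1: "1 \<le> z i" if "i \<le> d" for i using \<mu>[OF that] that by (simp add: z_def)
      define Z where "Z = sum z {..d}"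
      have "z 0 \<le> Z" unfolding Z_def using z1 by (intro member_le_sum) (auto intro: order_trans[OF zero_le_one])
      then have Z: "0 < Z" using z1[of 0] by simp
      define x where "x i = z i / Z" for i
      have x: "x \<in> face {..d}"
      proof -
        have "0 \<le> z i" for i using z1[of i] by (cases "i \<le> d") (auto simp: z_def)
        moreover have "sum x {..d} = 1" unfolding x_def using Z by (simp add: Z_def flip: sum_divide_distrib)
        ultimately show ?thesis using Z by (auto simp: face_def x_def z_def)
      qed
      have m: "Min (x ` {..d}) = 1 / Z"
      proof (rule Min_eqI)
        show "1 / Z \<le> w" if "w \<in> x ` {..d}" for w
          using that z1 Z by (auto simp: x_def divide_right_mono)
        have "\<mu> \<in> u ` {..d}" unfolding \<mu>_def by (rule Min_in) auto
        then obtain i where "i \<le> d" "u i = \<mu>" by auto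
        then have "x i = 1 / Z" by (simp add: x_def z_def)
        then show "1 / Z \<in> x ` {..d}" using \<open>i \<le> d\<close> by (metis atMost_iff image_eqI)
      qed simp
      have diff: "x i - x 0 = u i / Z" if "i \<le> d" for i
        using that by (simp add: x_def z_def u_def flip: diff_divide_distrib)
      have "(\<Sum>j\<le>d. (x j - x 0)\<^sup>2) = (\<Sum>j\<in>{..d}-{0}. (y j)\<^sup>2 / (a\<^sup>2 * Z\<^sup>2))"
        by (intro sum.mono_neutral_cong_right) (auto simp: diff u_def power_divide power_mult_distrib)
      also have "\<dots> = (1 - (y 0)\<^sup>2) / (a\<^sup>2 * Z\<^sup>2)"
        by (simp only: split flip: sum_divide_distrib)
      also have "\<dots> = (1 + y 0) / (a * Z\<^sup>2)"
      proof -
        have "1 - (y 0)\<^sup>2 = a * (1 + y 0)" by (simp add: a_def power2_eq_square algebra_simps)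
        then show ?thesis using a by (simp add: power2_eq_square)
      qed
      finally have s: "(\<Sum>j\<le>d. (x j - x 0)\<^sup>2) = (1 + y 0) / (a * Z\<^sup>2)" .
      have c: "(1 + y 0) / (a * Z\<^sup>2) + (1 / Z)\<^sup>2 = 2 / (a * Z\<^sup>2)"
        using a Z by (simp add: field_simps) (simp add: a_def algebra_simps power2_eq_square)
      have c': "(1 + y 0) / (a * Z\<^sup>2) - (1 / Z)\<^sup>2 = 2 * y 0 / (a * Z\<^sup>2)"
        using a Z by (simp add: field_simps) (simp add: a_def algebra_simps power2_eq_square)
      have "simplex_to_sphere d x i = y i" for i
      proof -
        consider "i = 0" | "i \<noteq> 0" "i \<le> d" | "i > d" by linarith
        then show ?thesis
        proof cases
          case 1
          then show ?thesis unfolding simplex_to_sphere_def Let_def s m using a Z by (simp add: c c')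
        next
          case 2
          then have "simplex_to_sphere d x i = 2 * (1 / Z) * (u i / Z) / (2 / (a * Z\<^sup>2))"
            unfolding simplex_to_sphere_def Let_def s m by (simp add: c diff)
          also have "\<dots> = y i" using 2 a Z by (simp add: u_def field_simps power2_eq_square)
          finally show ?thesis .
        next
          case 3
          then show ?thesis using y(2) by (simp add: simplex_to_sphere_def Let_def)
        qed
      qed
      then have "simplex_to_sphere d x = y" by blast
      then show ?thesis using x by blast
    qed
  qed
qed

lemma continuous_map_simplex_to_sphere:
  "continuous_map (subtopology (powertop_real UNIV) (face {..d})) (nsphere d) (simplex_to_sphere d)"
proof -
  let ?X = "subtopology (powertop_real UNIV) (face {..d})"
  have pr: "continuous_map ?X euclideanreal (\<lambda>x. x j)" for j
    by (intro continuous_map_from_subtopology continuous_map_product_projection) simp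
  have m: "continuous_map ?X euclideanreal (\<lambda>x. Min (x ` {..d}))"
    using continuous_map_Min[of "{..d}" ?X "\<lambda>j x. x j"] pr by simp
  have s: "continuous_map ?X euclideanreal (\<lambda>x. \<Sum>j\<le>d. (x j - x 0)\<^sup>2)"
    by (intro continuous_map_sum continuous_map_real_pow continuous_map_diff pr) simp
  have "continuous_map ?X euclideanreal (\<lambda>x. simplex_to_sphere d x i)" for i
  proof -
    have "(\<Sum>j\<le>d. (x j - x 0)\<^sup>2) + (Min (x ` {..d}))\<^sup>2 \<noteq> 0" if "x \<in> topspace ?X" for x
      using simplex_to_sphere_denominator[of x d] that by simp
    then have
      "continuous_map ?X euclideanreal (\<lambda>x. ((\<Sum>j\<le>d. (x j - x 0)\<^sup>2) - (Min (x ` {..d}))\<^sup>2)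
         / ((\<Sum>j\<le>d. (x j - x 0)\<^sup>2) + (Min (x ` {..d}))\<^sup>2))"
      "continuous_map ?X euclideanreal (\<lambda>x. 2 * Min (x ` {..d}) * (x i - x 0)
         / ((\<Sum>j\<le>d. (x j - x 0)\<^sup>2) + (Min (x ` {..d}))\<^sup>2))"
      by (intro continuous_map_real_divide continuous_map_real_mult continuous_map_add continuous_map_diff
          continuous_map_real_pow pr m s; simp)+
    then show ?thesis
      unfolding simplex_to_sphere_def Let_def by (cases "i = 0"; cases "i \<le> d") simp_all
  qed
  then have "continuous_map ?X (powertop_real UNIV) (simplex_to_sphere d)"
    by (simp add: continuous_map_componentwise_UNIV)
  then show ?thesis
    using simplex_to_sphere_in_nsphere unfolding nsphere by (auto simp: continuous_map_in_subtopology nsphere)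
qed

section \<open>From the standard simplex to arbitrary simplices and complexes\<close>

lemma reindex_face:
  fixes e :: "nat \<Rightarrow> 'a"
  assumes e: "bij_betw e {..d} \<sigma>"
  shows "(\<lambda>x j. if j \<le> d then x (e j) else 0) ` face \<sigma> = face {..d}"
    and "inj_on (\<lambda>x j. if j \<le> d then x (e j) else 0) (face \<sigma>)"
proof -
  let ?r = "\<lambda>(x::'a \<Rightarrow> real) j. if j \<le> d then x (e j) else 0"
  have e': "e j \<in> \<sigma>" if "j \<le> d" for j using e that by (auto simp: bij_betw_def)
  have ex: "\<exists>j\<le>d. v = e j" if "v \<in> \<sigma>" for v using e that by (auto simp: bij_betw_def)
  show "?r ` face \<sigma> = face {..d}"
  proof
    show "?r ` face \<sigma> \<subseteq> face {..d}"
    proof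
      fix y assume "y \<in> ?r ` face \<sigma>"
      then obtain x where x: "x \<in> face \<sigma>" "y = ?r x" by blast
      have "sum y {..d} = (\<Sum>j\<le>d. x (e j))" using x(2) by simp
      also have "\<dots> = sum x \<sigma>" by (rule sum.reindex_bij_betw[OF e])
      finally show "y \<in> face {..d}" using x by (auto simp: face_def)
    qed
    show "face {..d} \<subseteq> ?r ` face \<sigma>"
    proof
      fix y assume y: "y \<in> face {..d}"
      define x where "x v = (if v \<in> \<sigma> then y (inv_into {..d} e v) else 0)" for v
      have xe: "x (e j) = y j" if "j \<le> d" for j
        using e e'[OF that] that by (simp add: x_def bij_betw_def)
      have "sum x \<sigma> = sum y {..d}"
        unfolding sum.reindex_bij_betw[OF e, symmetric] using xe by (intro sum.cong) auto
      then have "x \<in> face \<sigma>" using y by (auto simp: face_def x_def)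
      moreover have "?r x = y" using faceD(2)[OF y] xe by (auto simp: fun_eq_iff)
      ultimately show "y \<in> ?r ` face \<sigma>" by blast
    qed
  qed
  show "inj_on ?r (face \<sigma>)"
  proof (rule inj_onI)
    fix x y assume x: "x \<in> face \<sigma>" and y: "y \<in> face \<sigma>" and eq: "?r x = ?r y"
    have "x v = y v" for v
    proof (cases "v \<in> \<sigma>")
      case True
      then obtain j where "j \<le> d" "v = e j" using ex by blast
      then show ?thesis using fun_cong[OF eq, of j] by simp
    next
      case False
      then show ?thesis using x y by (simp add: face_def)
    qed
    then show "x = y" by blast
  qed
qed

lemma face_collapse_to_sphere:
  assumes "finite \<sigma>" "card \<sigma> = Suc d" "1 \<le> d"
  obtains G where "quotient_map (subtopology (powertop_real UNIV) (face \<sigma>)) (nsphere d) G"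
    and "\<And>x. x \<in> face \<sigma> \<Longrightarrow> G x = (\<lambda>i. if i = 0 then 1 else 0) \<longleftrightarrow> (\<exists>v\<in>\<sigma>. x v = 0)"
    and "\<And>x y. \<lbrakk>x \<in> face \<sigma>; y \<in> face \<sigma>; \<forall>v\<in>\<sigma>. x v \<noteq> 0; \<forall>v\<in>\<sigma>. y v \<noteq> 0; G x = G y\<rbrakk> \<Longrightarrow> x = y"
proof -
  obtain e where "bij_betw e {0..<card \<sigma>} \<sigma>" using ex_bij_betw_nat_finite[OF assms(1)] by blast
  moreover have "{0..<card \<sigma>} = {..d}" using assms(2) by auto
  ultimately have e: "bij_betw e {..d} \<sigma>" by simp
  define \<rho> where "\<rho> = (\<lambda>(x::'a \<Rightarrow> real) j. if j \<le> d then x (e j) else 0)"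
  let ?X = "subtopology (powertop_real UNIV) (face \<sigma>)"
  let ?Y = "subtopology (powertop_real UNIV) (face {..d})"
  have r: "\<rho> ` face \<sigma> = face {..d}" "inj_on \<rho> (face \<sigma>)"
    using reindex_face[OF e] by (simp_all add: \<rho>_def)
  have r0: "(\<exists>j\<le>d. \<rho> x j = 0) \<longleftrightarrow> (\<exists>v\<in>\<sigma>. x v = 0)" for x
    using e by (auto simp: \<rho>_def bij_betw_def)
  have rin: "\<rho> x \<in> face {..d}" if "x \<in> face \<sigma>" for x using r(1) that by blast
  have "continuous_map ?X euclideanreal (\<lambda>x. \<rho> x j)" for j
    by (cases "j \<le> d")
      (auto simp: \<rho>_def intro!: continuous_map_from_subtopology continuous_map_product_projection)
  then have "continuous_map ?X (powertop_real UNIV) \<rho>"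
    by (simp add: continuous_map_componentwise_UNIV)
  then have "continuous_map ?X ?Y \<rho>"
    using rin by (simp add: continuous_map_in_subtopology image_subset_iff)
  then have "continuous_map ?X (nsphere d) (simplex_to_sphere d \<circ> \<rho>)"
    using continuous_map_simplex_to_sphere by (rule continuous_map_compose)
  moreover have "compact_space ?X"
    using compactin_face[OF assms(1)] compact_space_subtopology by blast
  moreover have "Hausdorff_space (nsphere d)"
    unfolding nsphere_def by (intro Hausdorff_space_subtopology Hausdorff_Euclidean_space)
  moreover have "(simplex_to_sphere d \<circ> \<rho>) ` topspace ?X = topspace (nsphere d)"
    using r(1) simplex_to_sphere_surj[OF assms(3)] by (simp del: o_apply add: image_comp[symmetric])
  ultimately have "quotient_map ?X (nsphere d) (simplex_to_sphere d \<circ> \<rho>)"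
    by (rule continuous_imp_quotient_map)
  then show ?thesis
  proof (rule that)
    fix x y assume x: "x \<in> face \<sigma>" and y: "y \<in> face \<sigma>"
      and nz: "\<forall>v\<in>\<sigma>. x v \<noteq> 0" "\<forall>v\<in>\<sigma>. y v \<noteq> 0"
      and eq: "(simplex_to_sphere d \<circ> \<rho>) x = (simplex_to_sphere d \<circ> \<rho>) y"
    have "\<forall>j\<le>d. \<rho> x j \<noteq> 0" using r0[of x] nz(1) by blast
    moreover have "\<forall>j\<le>d. \<rho> y j \<noteq> 0" using r0[of y] nz(2) by blast
    moreover have "simplex_to_sphere d (\<rho> x) = simplex_to_sphere d (\<rho> y)" using eq by simp
    ultimately have "\<rho> x = \<rho> y" using simplex_to_sphere_inj rin[OF x] rin[OF y] by blast
    then show "x = y" using r(2) x y by (meson inj_onD)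
  next
    fix x assume "x \<in> face \<sigma>"
    then show "(simplex_to_sphere d \<circ> \<rho>) x = (\<lambda>i. if i = 0 then 1 else 0) \<longleftrightarrow> (\<exists>v\<in>\<sigma>. x v = 0)"
      using simplex_to_sphere_eq_base[OF rin] r0 by simp
  qed
qed

text \<open>The map is pasted from the constant base point on \<open>L\<close> and one collapse onto
  a sphere per remaining simplex. The pieces agree because a remaining simplex meets every other
  simplex only in its boundary, which goes to the base point.\<close>

lemma realization_wedge_quotient:
  fixes K L :: "'a set set"
  assumes finV: "finite V" and K: "simplicial V r K" and L: "simplicial V r L" and sub: "L \<subseteq> K"
    and ne: "topspace (geometric_realization L) \<noteq> {}"
    and crit: "\<And>\<sigma>. \<sigma> \<in> K - L \<Longrightarrow> card \<sigma> = Suc d" and d: "1 \<le> d"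
  obtains Q where "quotient_map (geometric_realization K) (wedge_of_spheres (card (K - L)) d) Q"
    and "\<And>x. x \<in> topspace (geometric_realization L) \<Longrightarrow> Q x = None"
    and "\<And>x y. x \<in> topspace (geometric_realization K) \<Longrightarrow> y \<in> topspace (geometric_realization K)
      \<Longrightarrow> Q x = Q y \<Longrightarrow> x = y \<or> x \<in> topspace (geometric_realization L) \<and> y \<in> topspace (geometric_realization L)"
proof -
  define M where "M = card (K - L)"
  define b :: "nat \<Rightarrow> nat \<Rightarrow> real" where "b = (\<lambda>_ i. if i = 0 then 1 else 0)"
  define W where "W = wedge_of_spheres M d"
  have W: "W = wedge_sum {..<M} (\<lambda>_. nsphere d) b" by (simp add: W_def wedge_of_spheres_def b_def)
  note tK = topspace_geometric_realization[OF K finV] and tL = topspace_geometric_realization[OF L finV]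
  have finK: "finite K"
    by (rule finite_subset[of _ "Pow V"]) (use K finV in \<open>auto simp: simplicial_def\<close>)
  have fin: "finite \<sigma>" if "\<sigma> \<in> K" for \<sigma>
    by (rule finite_subset[OF _ finV]) (use K that in \<open>simp add: simplicial_def\<close>)
  have down: "\<tau> \<in> K" if "\<sigma> \<in> K" "\<tau> \<subseteq> \<sigma>" for \<sigma> \<tau> using K that unfolding simplicial_def by metis
  have downL: "\<tau> \<in> L" if "\<sigma> \<in> L" "\<tau> \<subseteq> \<sigma>" for \<sigma> \<tau> using L that unfolding simplicial_def by metis
  obtain \<sigma> where "bij_betw \<sigma> {0..<M} (K - L)"
    using ex_bij_betw_nat_finite[of "K - L"] finK unfolding M_def by blast
  then have s: "\<sigma> ` {..<M} = K - L" "inj_on \<sigma> {..<M}" by (simp_all add: bij_betw_def atLeast0LessThan)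
  have sK: "\<sigma> i \<in> K" "\<sigma> i \<notin> L" if "i < M" for i using s(1) that by blast+
  \<comment> \<open>Packing the properties of a collapse into one predicate lets a single choice
    produce the whole family \<open>G\<close>.\<close>
  define good where "good i G \<longleftrightarrow> quotient_map (subtopology (powertop_real UNIV) (face (\<sigma> i))) (nsphere d) G \<and>
     (\<forall>x. x \<in> face (\<sigma> i) \<longrightarrow> (G x = b i \<longleftrightarrow> (\<exists>v\<in>\<sigma> i. x v = 0))) \<and>
     (\<forall>x y. x \<in> face (\<sigma> i) \<and> y \<in> face (\<sigma> i) \<and> (\<forall>v\<in>\<sigma> i. x v \<noteq> 0) \<and> (\<forall>v\<in>\<sigma> i. y v \<noteq> 0) \<and> G x = G y \<longrightarrow> x = y)" for i G
  have "\<exists>G. good i G" if "i < M" for i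
  proof -
    have "card (\<sigma> i) = Suc d" using crit sK[OF that] by blast
    then show ?thesis
    proof (rule face_collapse_to_sphere[OF fin[OF sK(1)[OF that]] _ d])
      fix G
      assume "quotient_map (subtopology (powertop_real UNIV) (face (\<sigma> i))) (nsphere d) G"
        and "\<And>x. x \<in> face (\<sigma> i) \<Longrightarrow> G x = (\<lambda>i. if i = 0 then 1 else 0) \<longleftrightarrow> (\<exists>v\<in>\<sigma> i. x v = 0)"
        and inj: "\<And>x y. \<lbrakk>x \<in> face (\<sigma> i); y \<in> face (\<sigma> i); \<forall>v\<in>\<sigma> i. x v \<noteq> 0; \<forall>v\<in>\<sigma> i. y v \<noteq> 0; G x = G y\<rbrakk> \<Longrightarrow> x = y"
      then show ?thesis
        unfolding good_def b_def by (intro exI[of _ G] conjI allI impI) (assumption | elim conjE | rule inj)+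
    qed
  qed
  then have "\<forall>i\<in>{..<M}. \<exists>G. good i G" by simp
  from bchoice[OF this] obtain G where "\<forall>i\<in>{..<M}. good i (G i)" by (elim exE)
  then have good: "good i (G i)" if "i < M" for i using that by simp
  have G: "\<And>i. i < M \<Longrightarrow> quotient_map (subtopology (powertop_real UNIV) (face (\<sigma> i))) (nsphere d) (G i)"
    and Gb: "\<And>i x. i < M \<Longrightarrow> x \<in> face (\<sigma> i) \<Longrightarrow> G i x = b i \<longleftrightarrow> (\<exists>v\<in>\<sigma> i. x v = 0)"
    and Ginj: "\<And>i x y. \<lbrakk>i < M; x \<in> face (\<sigma> i); y \<in> face (\<sigma> i); \<forall>v\<in>\<sigma> i. x v \<noteq> 0; \<forall>v\<in>\<sigma> i. y v \<noteq> 0; G i x = G i y\<rbrakk> \<Longrightarrow> x = y"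
    using good unfolding good_def by blast+
  define F where "F i x = wedge_proj b (i, G i x)" for i x
  have FNone: "F i x = None \<longleftrightarrow> (\<exists>v\<in>\<sigma> i. x v = 0)" if "i < M" "x \<in> face (\<sigma> i)" for i x
    using Gb[OF that] by (simp add: F_def wedge_proj_def)
  \<comment> \<open>Otherwise \<open>\<sigma> i\<close> would be a face of \<tau>: if \<tau> is in
    \<open>L\<close>, then so is \<open>\<sigma> i\<close>; if not, both have \<open>Suc d\<close>
    vertices and coincide.\<close>
  have zero: "\<exists>v\<in>\<sigma> i. x v = 0" if "i < M" "x \<in> face (\<sigma> i)" "\<tau> \<in> K" "x \<in> face \<tau>" "\<tau> \<noteq> \<sigma> i" for i x \<tau>
  proof (rule ccontr)
    assume "\<not> (\<exists>v\<in>\<sigma> i. x v = 0)"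
    then have sub: "\<sigma> i \<subseteq> \<tau>" using faceD(2)[OF that(4)] by blast
    show False
    proof (cases "\<tau> \<in> L")
      case True
      then show False using downL[OF True sub] sK that(1) by blast
    next
      case False
      then have "card \<tau> = card (\<sigma> i)" using crit[of \<tau>] crit[of "\<sigma> i"] sK[OF that(1)] that(3) by simp
      then show False using card_subset_eq[OF fin[OF that(3)] sub] that(5) by simp
    qed
  qed
  let ?P = "powertop_real UNIV :: ('a \<Rightarrow> real) topology"
  let ?K = "geometric_realization K"
  have subK: "?K = subtopology ?P (\<Union>\<sigma>\<in>K. face \<sigma>)" using tK unfolding geometric_realization_def by simp
  have clo: "closedin ?K (face \<tau>)" if "\<tau> \<in> K" for \<tau>
  proof -
    have "Hausdorff_space ?P" by (simp add: Hausdorff_space_product_topology)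
    then have "closedin ?P (face \<tau>)" using compactin_face[OF fin[OF that]] compactin_imp_closedin by blast
    then show ?thesis unfolding subK using that by (intro closedin_subset_topspace) auto
  qed
  have subface: "subtopology ?K (face \<tau>) = subtopology ?P (face \<tau>)" if "\<tau> \<in> K" for \<tau>
    unfolding subK subtopology_subtopology using that by (metis Int_absorb1 UN_upper)
  define T where "T = case_option (\<Union>\<tau>\<in>L. face \<tau>) (\<lambda>i. face (\<sigma> i))"
  define f where "f = case_option (\<lambda>x. None) F"
  let ?I = "insert None (Some ` {..<M})"
  have cover: "topspace ?K = (\<Union>\<tau>\<in>L. face \<tau>) \<union> (\<Union>i<M. face (\<sigma> i))"
  proof -
    have "K = L \<union> \<sigma> ` {..<M}" using s(1) sub by blast
    then show ?thesis unfolding tK by blast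
  qed
  have contF: "continuous_map (subtopology ?P (face (\<sigma> i))) W (F i)" if "i < M" for i
  proof -
    have "continuous_map (subtopology ?P (face (\<sigma> i))) (sum_topology (\<lambda>_. nsphere d) {..<M}) (Pair i \<circ> G i)"
      using quotient_imp_continuous_map[OF G[OF that]] that
      by (intro continuous_map_compose[OF _ continuous_map_component_injection]) auto
    moreover have "continuous_map (sum_topology (\<lambda>_. nsphere d) {..<M}) W (wedge_proj b)"
      unfolding W using that in_topspace_nsphere
      by (intro quotient_imp_continuous_map quotient_map_wedge_proj) (auto simp: b_def)
    ultimately have "continuous_map (subtopology ?P (face (\<sigma> i))) W (wedge_proj b \<circ> (Pair i \<circ> G i))"
      by (rule continuous_map_compose)
    then show ?thesis by (simp add: F_def[abs_def] o_def)
  qed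
  obtain Q where contQ: "continuous_map ?K W Q"
    and Q: "\<And>x j. j \<in> ?I \<Longrightarrow> x \<in> topspace ?K \<inter> T j \<Longrightarrow> Q x = f j x"
  proof (rule pasting_lemma_exists_closed[of ?I ?K T W f])
    show "topspace ?K \<subseteq> \<Union> (T ` ?I)" unfolding cover by (auto simp: T_def)
    show "closedin ?K (T j)" if "j \<in> ?I" for j
    proof (cases j)
      case None
      have "closedin ?K (\<Union>\<tau>\<in>L. face \<tau>)"
        using finite_subset[OF sub finK] sub by (intro closedin_Union) (auto intro: clo)
      then show ?thesis by (simp add: None T_def)
    next
      case (Some i)
      then show ?thesis using that sK clo by (auto simp: T_def)
    qed
    show "continuous_map (subtopology ?K (T j)) W (f j)" if "j \<in> ?I" for j
    proof (cases j)
      case None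
      have "None \<in> topspace W" by (simp add: W topspace_wedge_sum)
      then show ?thesis by (simp add: None f_def)
    next
      case (Some i)
      then have "i < M" using that by auto
      then show ?thesis using contF subface sK by (simp add: Some f_def T_def)
    qed
    have 1: "f (Some i) x = None" if "i < M" "x \<in> T None" "x \<in> T (Some i)" for i x
    proof -
      obtain \<tau> where "\<tau> \<in> L" "x \<in> face \<tau>" using \<open>x \<in> T None\<close> by (auto simp: T_def)
      then show ?thesis using zero[of i x \<tau>] FNone[of i x] that sub sK(2) by (auto simp: f_def T_def)
    qed
    have 2: "f (Some i) x = f (Some j) x" if "i < M" "j < M" "x \<in> T (Some i)" "x \<in> T (Some j)" for i j x
    proof (cases "i = j")
      case False
      then have "\<sigma> i \<noteq> \<sigma> j" using s(2) that by (auto simp: inj_on_def)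
      then show ?thesis
        using zero[of i x "\<sigma> j"] zero[of j x "\<sigma> i"] FNone[of i x] FNone[of j x] that sK by (auto simp: f_def T_def)
    qed simp
    show "f i x = f j x" if "i \<in> ?I" "j \<in> ?I" "x \<in> topspace ?K \<inter> T i \<inter> T j" for i j x
    proof -
      have x: "x \<in> T i" "x \<in> T j" using that(3) by auto
      have fN: "f None x = None" by (simp add: f_def)
      have i: "i = None \<or> (\<exists>k<M. i = Some k)" and j: "j = None \<or> (\<exists>k<M. j = Some k)"
        using that(1,2) by auto
      from i show ?thesis
      proof (elim disjE exE conjE)
        assume "i = None"
        from j show ?thesis using 1[of _ x] x fN \<open>i = None\<close> by (elim disjE exE conjE) simp_all
      next
        fix k assume k: "k < M" "i = Some k"
        from j show ?thesis
        proof (elim disjE exE conjE)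
          assume "j = None"
          then show ?thesis using 1[OF k(1)] x fN k(2) by simp
        next
          fix l assume l: "l < M" "j = Some l"
          show ?thesis using 2[OF k(1) l(1)] x k(2) l(2) by simp
        qed
      qed
    qed
    show "finite ?I" by simp
  qed (rule that)
  have QL: "Q x = None" if "x \<in> topspace (geometric_realization L)" for x
    using Q[of None x] that sub unfolding tL tK by (auto simp: T_def f_def)
  have QF: "Q x = F i x" if "i < M" "x \<in> face (\<sigma> i)" for x i
    using Q[of "Some i" x] that sK unfolding tK by (auto simp: T_def f_def)
  \<comment> \<open>A point with a vanishing coordinate lies in a facet, and a facet has too few
    vertices to be outside \<open>L\<close>.\<close>
  have interior: "\<exists>i<M. x \<in> face (\<sigma> i) \<and> (\<forall>v\<in>\<sigma> i. x v \<noteq> 0)"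
    if x: "x \<in> topspace ?K" "x \<notin> topspace (geometric_realization L)" for x
  proof -
    obtain i where i: "i < M" "x \<in> face (\<sigma> i)" using x unfolding cover tL by blast
    have "x v \<noteq> 0" if v: "v \<in> \<sigma> i" for v
    proof
      assume "x v = 0"
      have "sum x (\<sigma> i) = sum x (\<sigma> i - {v})"
        using \<open>x v = 0\<close> fin[OF sK(1)[OF i(1)]] v by (simp add: sum_diff1)
      then have "x \<in> face (\<sigma> i - {v})" using i(2) \<open>x v = 0\<close> by (auto simp: face_def)
      moreover have "card (\<sigma> i - {v}) \<noteq> Suc d"
        using crit[of "\<sigma> i"] sK[OF i(1)] v fin by simp
      then have "\<sigma> i - {v} \<in> L" using crit[of "\<sigma> i - {v}"] down[OF sK(1)[OF i(1)], of "\<sigma> i - {v}"] by blast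
      ultimately show False using \<open>x \<notin> topspace (geometric_realization L)\<close> unfolding tL by blast
    qed
    then show ?thesis using i by blast
  qed
  have "Q ` topspace ?K = topspace W"
  proof
    show "Q ` topspace ?K \<subseteq> topspace W" using contQ by (simp add: continuous_map_image_subset_topspace)
    show "topspace W \<subseteq> Q ` topspace ?K"
    proof
      fix w assume "w \<in> topspace W"
      then consider "w = None" | i y where "i < M" "y \<in> topspace (nsphere d)" "w = wedge_proj b (i, y)"
        unfolding W topspace_wedge_sum by auto
      then show "w \<in> Q ` topspace ?K"
      proof cases
        case 1
        \<comment> \<open>The base point is hit from \<open>L\<close>, which also settles the wedge
          of zero spheres.\<close>
        obtain x where x: "x \<in> topspace (geometric_realization L)" using ne by blast
        then have "x \<in> topspace ?K" using sub unfolding tK tL by blast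
        then show ?thesis using QL[OF x] 1 by (metis image_eqI)
      next
        case 2
        then obtain x where x: "x \<in> face (\<sigma> i)" "y = G i x"
          using quotient_imp_surjective_map[OF G[OF 2(1)]] by auto
        then have "Q x = w" using QF 2 by (simp add: F_def)
        moreover have "x \<in> topspace ?K" using x(1) sK[OF 2(1)] unfolding tK by blast
        ultimately show ?thesis by blast
      qed
    qed
  qed
  moreover have "openin W U" if U: "U \<subseteq> topspace W" and op: "openin ?K {x \<in> topspace ?K. Q x \<in> U}" for U
    unfolding W openin_wedge_sum
  proof
    show "U \<subseteq> insert None (wedge_proj b ` topspace (sum_topology (\<lambda>_. nsphere d) {..<M}))"
      using U unfolding W topspace_wedge_sum .
    \<comment> \<open>Openness in the wedge is openness in every summand, where it can be tested in
      the simplex because \<open>G i\<close> is a quotient map.\<close>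
    have "openin (nsphere d) {y \<in> topspace (nsphere d). wedge_proj b (i, y) \<in> U}" if "i < M" for i
    proof -
      have "openin (subtopology ?K (face (\<sigma> i))) ({x \<in> topspace ?K. Q x \<in> U} \<inter> face (\<sigma> i))"
        using op by (auto simp: openin_subtopology)
      moreover have "{x \<in> topspace ?K. Q x \<in> U} \<inter> face (\<sigma> i)
          = {x \<in> topspace (subtopology ?P (face (\<sigma> i))). G i x \<in> {y \<in> topspace (nsphere d). wedge_proj b (i, y) \<in> U}}"
      proof (rule set_eqI)
        fix x
        show "x \<in> {x \<in> topspace ?K. Q x \<in> U} \<inter> face (\<sigma> i) \<longleftrightarrow>
          x \<in> {x \<in> topspace (subtopology ?P (face (\<sigma> i))). G i x \<in> {y \<in> topspace (nsphere d). wedge_proj b (i, y) \<in> U}}"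
        proof (cases "x \<in> face (\<sigma> i)")
          case True
          have "x \<in> topspace ?K" using True sK(1)[OF that] unfolding tK by blast
          moreover have "Q x = wedge_proj b (i, G i x)" using QF[OF that True] by (simp add: F_def)
          moreover have "G i x \<in> topspace (nsphere d)"
            using quotient_imp_surjective_map[OF G[OF that]] True by auto
          ultimately show ?thesis using True by simp
        qed simp
      qed
      ultimately have "openin (subtopology ?P (face (\<sigma> i)))
          {x \<in> topspace (subtopology ?P (face (\<sigma> i))). G i x \<in> {y \<in> topspace (nsphere d). wedge_proj b (i, y) \<in> U}}"
        unfolding subface[OF sK(1)[OF that]] by (simp only:)
      moreover have "{y \<in> topspace (nsphere d). wedge_proj b (i, y) \<in> U} \<subseteq> topspace (nsphere d)"
        by (rule Collect_subset)
      ultimately show ?thesis using G[OF that] unfolding quotient_map_def by (simp only:)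
    qed
    then show "openin (sum_topology (\<lambda>_. nsphere d) {..<M})
        {p \<in> topspace (sum_topology (\<lambda>_. nsphere d) {..<M}). wedge_proj b p \<in> U}"
      unfolding openin_sum_topology by (intro conjI ballI) (auto simp: topspace_sum_topology)
  qed
  ultimately have "quotient_map ?K W Q"
    unfolding quotient_map_def using openin_continuous_map_preimage[OF contQ] by (intro conjI allI impI iffI)
  then show ?thesis
  proof (rule that[unfolded M_def[symmetric] W_def[symmetric]])
    show "Q x = None" if "x \<in> topspace (geometric_realization L)" for x by (rule QL[OF that])
    fix x y assume xy: "x \<in> topspace ?K" "y \<in> topspace ?K" "Q x = Q y"
    have some: "Q z \<noteq> None" if z: "z \<in> topspace ?K" "z \<notin> topspace (geometric_realization L)" for z
    proof -
      obtain i where "i < M" "z \<in> face (\<sigma> i)" "\<forall>v\<in>\<sigma> i. z v \<noteq> 0" using interior[OF z] by blast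
      then show ?thesis using FNone QF by metis
    qed
    show "x = y \<or> x \<in> topspace (geometric_realization L) \<and> y \<in> topspace (geometric_realization L)"
    proof (cases "x \<in> topspace (geometric_realization L) \<or> y \<in> topspace (geometric_realization L)")
      case True
      then show ?thesis using some[OF xy(1)] some[OF xy(2)] QL[of x] QL[of y] xy(3) by argo
    next
      case False
      obtain i where i: "i < M" "x \<in> face (\<sigma> i)" "\<forall>v\<in>\<sigma> i. x v \<noteq> 0" using interior[OF xy(1)] False by blast
      obtain j where j: "j < M" "y \<in> face (\<sigma> j)" "\<forall>v\<in>\<sigma> j. y v \<noteq> 0" using interior[OF xy(2)] False by blast
      have "wedge_proj b (i, G i x) = wedge_proj b (j, G j y)"
        using xy(3) QF i j by (simp add: F_def)
      then have "i = j" "G i x = G j y"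
        using Gb[OF i(1,2)] Gb[OF j(1,2)] i(3) j(3) by (auto simp: wedge_proj_def split: if_splits)
      then show ?thesis using Ginj[of i x y] i j by blast
    qed
  qed
qed

theorem (in general_position) homotopy_equivalent_wedge_of_spheres:
  assumes K: "simplicial V r K" and L: "cone_glued V r L" and sub: "L \<subseteq> K"
    and crit: "\<And>\<sigma>. \<sigma> \<in> K - L \<Longrightarrow> card \<sigma> = Suc d" and d: "1 \<le> d"
  shows "geometric_realization K homotopy_equivalent_space wedge_of_spheres (card (K - L)) d"
proof -
  let ?K = "geometric_realization K" and ?L = "geometric_realization L"
  have sL: "simplicial V r L" using L by (rule cone_glued_simplicial)
  note tK = topspace_geometric_realization[OF K finV] and tL = topspace_geometric_realization[OF sL finV]
  have imK: "bary ` topspace ?K = polyhedron_of K" and imL: "bary ` topspace ?L = polyhedron_of L"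
    unfolding tK tL polyhedron_of_def by simp_all
  have LK: "topspace ?L \<subseteq> topspace ?K" unfolding tK tL using sub by blast
  have AR: "AR (polyhedron_of L)" using L by (rule AR_cone_glued)
  then have "polyhedron_of L \<noteq> {}" by (simp add: AR_ANR)
  then have ne: "topspace ?L \<noteq> {}" using imL by blast
  obtain H a where H: "continuous_on ({0..1} \<times> polyhedron_of K) H" "H \<in> {0..1::real} \<times> polyhedron_of K \<rightarrow> polyhedron_of K"
    "\<And>x. x \<in> polyhedron_of K \<Longrightarrow> H (0, x) = x"
    "\<And>t x. t \<in> {0..1} \<Longrightarrow> x \<in> polyhedron_of L \<Longrightarrow> H (t, x) \<in> polyhedron_of L"
    "\<And>x. x \<in> polyhedron_of L \<Longrightarrow> H (1, x) = a"
  proof (rule AR_contraction_extension[of "polyhedron_of K" "polyhedron_of L"])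
    show "polyhedron_of L \<subseteq> polyhedron_of K" using LK imK imL by blast
  qed (use compact_polyhedron_of[OF K] ANR_polyhedron_of[OF K] AR compact_polyhedron_of[OF sL] in
      \<open>auto intro: compact_imp_closed\<close>)
  obtain \<psi> where \<psi>: "homeomorphic_maps ?K (top_of_set (polyhedron_of K)) bary \<psi>"
    using homeomorphic_map_bary[OF K] homeomorphic_map_maps by blast
  have \<psi>b: "\<psi> (bary x) = x" if "x \<in> topspace ?K" for x using \<psi> that by (simp add: homeomorphic_maps_def)
  have \<psi>L: "\<psi> z \<in> topspace ?L" if "z \<in> polyhedron_of L" for z
    using that LK \<psi>b unfolding imL[symmetric] by auto
  obtain Q where Q: "quotient_map ?K (wedge_of_spheres (card (K - L)) d) Q"
    "\<And>x. x \<in> topspace ?L \<Longrightarrow> Q x = None"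
    "\<And>x y. x \<in> topspace ?K \<Longrightarrow> y \<in> topspace ?K \<Longrightarrow> Q x = Q y \<Longrightarrow> x = y \<or> x \<in> topspace ?L \<and> y \<in> topspace ?L"
    using realization_wedge_quotient[OF finV K sL sub ne crit d] by blast
  show ?thesis
  \<comment> \<open>The homotopy is constructed in Euclidean space, while the quotient is one of the
    realization; conjugation by \<open>bary\<close> connects the two.\<close>
  proof (rule homotopy_equivalent_collapse[OF Q(1) LK, where H = "\<lambda>z. \<psi> (H (fst z, bary (snd z)))" and a = "\<psi> a"])
    show "Q x = Q y" if "x \<in> topspace ?L" "y \<in> topspace ?L" for x y using Q(2) that by simp
    show "x = y \<or> x \<in> topspace ?L \<and> y \<in> topspace ?L" if "x \<in> topspace ?K" "y \<in> topspace ?K" "Q x = Q y" for x y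
      using Q(3) that .
    have "continuous_map (prod_topology (top_of_set {0..1}) ?K) (prod_topology (top_of_set {0..1}) (top_of_set (polyhedron_of K)))
        (\<lambda>z. (fst z, bary (snd z)))"
      using \<psi> by (intro continuous_map_pairedI continuous_map_fst continuous_map_compose[OF continuous_map_snd, unfolded o_def])
        (auto simp: homeomorphic_maps_def)
    moreover have "continuous_map (prod_topology (top_of_set {0..1::real}) (top_of_set (polyhedron_of K))) (top_of_set (polyhedron_of K)) H"
      using H(1,2) by (simp add: continuous_map_in_subtopology image_subset_iff_funcset flip: subtopology_Times)
    moreover have "continuous_map (top_of_set (polyhedron_of K)) ?K \<psi>" using \<psi> by (simp add: homeomorphic_maps_def)
    ultimately have "continuous_map (prod_topology (top_of_set {0..1}) ?K) ?K (\<psi> \<circ> (H \<circ> (\<lambda>z. (fst z, bary (snd z)))))"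
      by (intro continuous_map_compose)
    then show "continuous_map (prod_topology (top_of_set {0..1}) ?K) ?K (\<lambda>z. \<psi> (H (fst z, bary (snd z))))"
      by (simp add: o_def)
    show "\<psi> (H (fst (0, x), bary (snd (0, x)))) = x" if "x \<in> topspace ?K" for x
    proof -
      have "bary x \<in> polyhedron_of K" using that unfolding imK[symmetric] by (rule imageI)
      then show ?thesis using H(3)[of "bary x"] \<psi>b[OF that] by simp
    qed
    show "\<psi> (H (fst (t, x), bary (snd (t, x)))) \<in> topspace ?L" if "t \<in> {0..1}" "x \<in> topspace ?L" for t x
    proof -
      have "bary x \<in> polyhedron_of L" using that(2) unfolding imL[symmetric] by (rule imageI)
      then show ?thesis using H(4)[OF that(1), of "bary x"] \<psi>L by simp
    qed
    show "\<psi> (H (fst (1, x), bary (snd (1, x)))) = \<psi> a" if "x \<in> topspace ?L" for x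
    proof -
      have "bary x \<in> polyhedron_of L" using that unfolding imL[symmetric] by (rule imageI)
      then show ?thesis using H(5)[of "bary x"] by simp
    qed
  qed
qed

section \<open>Contractible subcomplexes\<close>

definition graph_complex :: "'a set \<Rightarrow> 'a set set \<Rightarrow> 'a set set" where
  "graph_complex V E = insert {} ((\<lambda>v. {v}) ` V \<union> E)"

text \<open>As \<open>e\<close> and \<open>f\<close> may also be empty or single vertices, this
  includes all subsets of unions of two edges.\<close>

definition edge_pair_complex :: "'a set \<Rightarrow> 'a set set \<Rightarrow> 'a set set" where
  "edge_pair_complex V E = {e \<union> f | e f. e \<in> graph_complex V E \<and> f \<in> graph_complex V E}"

inductive tree :: "'a set \<Rightarrow> 'a set set \<Rightarrow> bool" where
  single: "tree {v} {}"
| leaf: "\<lbrakk>tree V T; v \<notin> V; u \<in> V\<rbrakk> \<Longrightarrow> tree (insert v V) (insert {u, v} T)"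

text \<open>The last argument counts the squares, i.e. the independent cycles of the graph.\<close>

inductive grown :: "'a set \<Rightarrow> 'a set set \<Rightarrow> nat \<Rightarrow> bool" where
  single: "grown {v} {} 0"
| pendant: "\<lbrakk>grown V E b; v \<notin> V; u \<in> V\<rbrakk> \<Longrightarrow> grown (insert v V) (insert {u, v} E) b"
| square: "\<lbrakk>grown V E b; v \<notin> V; u \<in> V; w \<in> V; u \<noteq> w; {u, x} \<in> E; {w, x} \<in> E; {u, w} \<notin> E;
    \<And>y. {u, y} \<in> E \<Longrightarrow> {w, y} \<in> E \<Longrightarrow> y = x\<rbrakk>
    \<Longrightarrow> grown (insert v V) (insert {u, v} (insert {w, v} E)) (Suc b)"

lemma tree_facts:
  assumes "tree V T"
  shows "finite V \<and> finite T \<and> V \<noteq> {} \<and> (\<forall>e\<in>T. e \<subseteq> V \<and> card e = 2) \<and> card T + 1 = card V"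
  using assms
proof induction
  case (leaf V T v u)
  then have "{u, v} \<notin> T" "u \<noteq> v" by auto
  with leaf show ?case by auto
qed simp

text \<open>The count is Euler's formula: a pendant vertex brings one edge, a vertex closing a
  square brings two edges and one cycle. Together with \<open>tree_facts\<close> it shows that a
  spanning tree misses exactly \<open>b\<close> edges.\<close>

lemma grown_facts:
  assumes "grown V E b"
  shows "finite V \<and> finite E \<and> V \<noteq> {} \<and> (\<forall>e\<in>E. e \<subseteq> V \<and> card e = 2) \<and> card E + 1 = card V + b"
  using assms
proof induction
  case (pendant V E b v u)
  then have "{u, v} \<notin> E" "u \<noteq> v" by auto
  with pendant show ?case by auto
next
  case (square V E b v u w x)
  then have "{u, v} \<notin> E" "{w, v} \<notin> E" using square.IH square.hyps(2) by blast+
  moreover have "{u, v} \<noteq> {w, v}" "u \<noteq> v" "w \<noteq> v"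
    using square.hyps(2-5) by (auto simp: doubleton_eq_iff)
  ultimately show ?case using square.IH square.hyps(2-4) by auto
qed simp

text \<open>Connectedness as a condition on cuts, the form in which a tree can be extended greedily.
  For both growth rules it is enough that one edge joins the new vertex to the old graph.\<close>

lemma grown_connected:
  assumes "grown V E b" "A \<subset> V" "A \<noteq> {}"
  shows "\<exists>p\<in>A. \<exists>q\<in>V - A. {p, q} \<in> E"
proof -
  have step: "\<exists>p\<in>A. \<exists>q\<in>insert v V - A. {p, q} \<in> E'"
    if IH: "\<And>A. A \<subset> V \<Longrightarrow> A \<noteq> {} \<Longrightarrow> \<exists>p\<in>A. \<exists>q\<in>V - A. {p, q} \<in> E"
      and v: "v \<notin> V" "u \<in> V" "{u, v} \<in> E'" "E \<subseteq> E'" and A: "A \<subset> insert v V" "A \<noteq> {}"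
    for V E E' v u and A :: "'a set"
  proof -
    consider "A = V" | "A = {v}" | "A - {v} \<subset> V" "A - {v} \<noteq> {}" using A v by blast
    then show ?thesis
    proof cases
      case 1
      then show ?thesis using v by blast
    next
      case 2
      then show ?thesis using v by (auto simp: insert_commute)
    next
      case 3
      from IH[OF 3] obtain p q where "p \<in> A - {v}" "q \<in> V - (A - {v})" "{p, q} \<in> E" by blast
      then have "p \<in> A" "q \<in> insert v V - A" "{p, q} \<in> E'" using v(1,4) by auto
      then show ?thesis by blast
    qed
  qed
  show ?thesis using assms
  proof (induction arbitrary: A)
    case (pendant V E b v u)
    show ?case by (rule step[OF pendant.IH pendant.hyps(2,3) _ _ pendant.prems]) auto
  next
    case (square V E b v u w x)
    show ?case by (rule step[OF square.IH square.hyps(2,3) _ _ square.prems]) auto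
  qed auto
qed

lemma tree_extends_to_spanning_tree:
  assumes "finite V" "\<And>A. A \<subset> V \<Longrightarrow> A \<noteq> {} \<Longrightarrow> \<exists>p\<in>A. \<exists>q\<in>V - A. {p, q} \<in> E"
    and "tree S T" "S \<subseteq> V" "T \<subseteq> E"
  shows "\<exists>T'. tree V T' \<and> T \<subseteq> T' \<and> T' \<subseteq> E"
  using assms(3-5)
proof (induction "card (V - S)" arbitrary: S T)
  case 0
  then have "S = V" using assms(1) by auto
  then show ?case using 0 by blast
next
  case (Suc k)
  have "S \<noteq> {}" using tree_facts[OF Suc.prems(1)] by blast
  moreover have "S \<subset> V" using Suc.hyps(2) Suc.prems(2) by auto
  ultimately obtain p q where pq: "p \<in> S" "q \<in> V - S" "{p, q} \<in> E" using assms(2) by blast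
  have "k = card (V - insert q S)"
    using Suc.hyps(2) pq(2) assms(1) by (simp add: card_Diff_insert)
  moreover have "tree (insert q S) (insert {p, q} T)" using Suc.prems(1) pq by (intro tree.leaf) auto
  ultimately have "\<exists>T'. tree V T' \<and> insert {p, q} T \<subseteq> T' \<and> T' \<subseteq> E"
    using Suc.prems pq by (intro Suc.hyps(1)[of "insert q S" "insert {p, q} T"]) auto
  then show ?case by blast
qed

lemma tree_star:
  assumes "finite S" "w \<notin> S"
  shows "tree (insert w S) ((\<lambda>s. {w, s}) ` S)"
  using assms
proof (induction S rule: finite_induct)
  case empty
  then show ?case by (simp add: tree.single)
next
  case (insert s S)
  then have "tree (insert s (insert w S)) (insert {w, s} ((\<lambda>s. {w, s}) ` S))"
    by (intro tree.leaf) auto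
  then show ?case by (simp add: insert_commute)
qed

section \<open>Trees, cones and attached vertices as glued complexes\<close>

lemma graph_complex_simplicial:
  assumes "V \<subseteq> U" "\<And>e. e \<in> E \<Longrightarrow> e \<subseteq> V \<and> card e = 2" "2 \<le> r"
  shows "simplicial U r (graph_complex V E)"
  unfolding simplicial_def
proof (intro conjI ballI allI impI)
  fix \<sigma> assume s: "\<sigma> \<in> graph_complex V E"
  show "\<sigma> \<subseteq> U" using s assms(1,2) by (auto simp: graph_complex_def)
  show "card \<sigma> \<le> r" using s assms(2,3) by (auto simp: graph_complex_def)
  fix \<tau> assume t: "\<tau> \<subseteq> \<sigma>"
  from s consider "\<sigma> = {}" | v where "v \<in> V" "\<sigma> = {v}" | "\<sigma> \<in> E" by (auto simp: graph_complex_def)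
  then show "\<tau> \<in> graph_complex V E"
  proof cases
    case 3
    then obtain p q where "\<sigma> = {p, q}" "p \<in> V" "q \<in> V" using assms(2)[OF 3] by (auto simp: card_2_iff)
    then have "\<tau> = {} \<or> \<tau> = {p} \<or> \<tau> = {q} \<or> \<tau> = \<sigma>" using t by auto
    then show ?thesis using 3 \<open>p \<in> V\<close> \<open>q \<in> V\<close> by (auto simp: graph_complex_def)
  qed (use t in \<open>auto simp: graph_complex_def subset_singleton_iff\<close>)
qed

lemma cone_glued_Pow:
  assumes "finite S" "S \<subseteq> U" "S \<noteq> {}" "card S \<le> r"
  shows "cone_glued U r (Pow S)"
proof -
  obtain v where "v \<in> S" using assms(3) by blast
  moreover have "card \<sigma> \<le> r" if "\<sigma> \<subseteq> S" for \<sigma> using card_mono[OF assms(1) that] assms(4) by simp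
  ultimately show ?thesis using assms(2)
    by (intro cone_glued.cone[where v = v]) (auto simp: simplicial_def)
qed

text \<open>Each leaf glues the edge \<open>{u, v}\<close> to the rest along the single vertex
  \<open>u\<close>.\<close>

lemma tree_cone_glued:
  assumes "tree V T" "V \<subseteq> U" "2 \<le> r"
  shows "cone_glued U r (graph_complex V T)"
  using assms
proof induction
  case (single v)
  have "graph_complex {v} {} = Pow {v}" by (auto simp: graph_complex_def)
  then show ?case using single by (simp add: cone_glued_Pow del: Pow_insert)
next
  case (leaf V T v u)
  have sub: "\<sigma> \<subseteq> V" if "\<sigma> \<in> graph_complex V T" for \<sigma>
    using tree_facts[OF leaf.hyps(1)] that by (auto simp: graph_complex_def)
  have 1: "graph_complex V T \<inter> Pow {u, v} = Pow {u}"
  proof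
    show "graph_complex V T \<inter> Pow {u, v} \<subseteq> Pow {u}" using sub leaf.hyps(2) by blast
    show "Pow {u} \<subseteq> graph_complex V T \<inter> Pow {u, v}"
      using leaf.hyps(3) by (auto simp: graph_complex_def subset_singleton_iff)
  qed
  have 2: "graph_complex (insert v V) (insert {u, v} T) = graph_complex V T \<union> Pow {u, v}"
    using leaf.hyps(3) by (auto simp: graph_complex_def Pow_insert)
  have "u \<noteq> v" using leaf.hyps by blast
  then show ?case unfolding 2 using leaf
    by (intro cone_glued.glue) (auto simp: 1 cone_glued_Pow simp del: Pow_insert)
qed

text \<open>The apex may already be a vertex of \<open>K\<close>, as happens for the cones with
  apexes \<open>u\<close> and \<open>w\<close> inside a link; therefore \<open>v\<close> is removed
  from a face before the face is compared with \<open>K\<close>.\<close>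

lemma cone_glued_cone_over:
  assumes K: "simplicial U r K" "\<And>\<sigma>. \<sigma> \<in> K \<Longrightarrow> card \<sigma> < r" "{} \<in> K" and v: "v \<in> U"
  shows "cone_glued U r (K \<union> insert v ` K)"
proof -
  let ?B = "K \<union> insert v ` K"
  have "simplicial U r ?B"
    unfolding simplicial_def
  proof (intro conjI ballI allI impI)
    fix \<sigma> assume s: "\<sigma> \<in> ?B"
    then obtain \<kappa> where k: "\<kappa> \<in> K" "\<sigma> = \<kappa> \<or> \<sigma> = insert v \<kappa>" by blast
    have kU: "\<kappa> \<subseteq> U" using K(1) k(1) unfolding simplicial_def by simp
    then show "\<sigma> \<subseteq> U" using k(2) v by blast
    show "card \<sigma> \<le> r" using K(2)[OF k(1)] k(2) card_insert_le_m1[of r \<kappa> v] by auto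
    fix \<tau> assume "\<tau> \<subseteq> \<sigma>"
    then have "\<tau> - {v} \<subseteq> \<kappa>" using k(2) by blast
    then have t: "\<tau> - {v} \<in> K" using K(1) k(1) unfolding simplicial_def by metis
    show "\<tau> \<in> ?B"
    proof (cases "v \<in> \<tau>")
      case True
      then have "\<tau> = insert v (\<tau> - {v})" by blast
      then show ?thesis using t by blast
    next
      case False
      then show ?thesis using t by simp
    qed
  qed
  then show ?thesis
    using K(3) by (intro cone_glued.cone[where v = v]) auto
qed

text \<open>A new vertex with link \<open>K\<close> adds the cone over \<open>K\<close>, and this
  cone meets the old complex in \<open>K\<close> itself.\<close>

lemma cone_glued_attach:
  assumes L: "cone_glued U r L" and K: "cone_glued U r K" "K \<subseteq> L" "\<And>\<sigma>. \<sigma> \<in> K \<Longrightarrow> card \<sigma> < r" "{} \<in> K"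
    and v: "v \<in> U" "\<And>\<sigma>. \<sigma> \<in> L \<Longrightarrow> v \<notin> \<sigma>"
  shows "cone_glued U r (L \<union> insert v ` K)"
proof -
  let ?B = "K \<union> insert v ` K"
  have "cone_glued U r ?B"
    using cone_glued_simplicial[OF K(1)] K(3,4) v(1) by (rule cone_glued_cone_over)
  moreover have "L \<inter> ?B = K" using K(2) v(2) by blast
  ultimately have "cone_glued U r (L \<union> ?B)" using L K(1) cone_glued.glue[of U r L ?B] by simp
  moreover have "L \<union> ?B = L \<union> insert v ` K" using K(2) by blast
  ultimately show ?thesis by simp
qed

section \<open>The link of a new vertex\<close>

lemma edge_pair_complex_insert:
  assumes "N \<subseteq> V"
  shows "edge_pair_complex (insert v V) ((\<lambda>n. {n, v}) ` N \<union> E) =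
    edge_pair_complex V E \<union> insert v ` (graph_complex V E \<union> (\<Union>n\<in>N. insert n ` graph_complex V E))"
    (is "?D' = ?D \<union> insert v ` ?K")
proof
  let ?C = "graph_complex V E" and ?C' = "graph_complex (insert v V) ((\<lambda>n. {n, v}) ` N \<union> E)"
  have C': "?C' = ?C \<union> insert {v} ((\<lambda>n. {n, v}) ` N)" by (auto simp: graph_complex_def)
  have n: "{n} \<in> ?C" if "n \<in> N" for n using assms that by (auto simp: graph_complex_def)
  have 0: "{} \<in> ?C" by (simp add: graph_complex_def)
  have K0: "insert v e \<in> insert v ` ?K" if "e \<in> ?C" for e using that by blast
  have K1: "insert v (insert n e) \<in> insert v ` ?K" if "e \<in> ?C" "n \<in> N" for e n using that by blast
  \<comment> \<open>If both parts are edges at \<open>v\<close>, the second contributes only its old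
    end, which is a simplex of the old graph complex; so one apex from \<open>N\<close> is
    enough.\<close>
  have half: "e \<union> f \<in> insert v ` ?K" if e: "e \<in> insert {v} ((\<lambda>n. {n, v}) ` N)" and f: "f \<in> ?C'" for e f
  proof -
    from e f consider "e = {v}" "f \<in> ?C" | "e = {v}" "f = {v}" | n where "e = {v}" "n \<in> N" "f = {n, v}"
      | n where "n \<in> N" "e = {n, v}" "f \<in> ?C" | n where "n \<in> N" "e = {n, v}" "f = {v}"
      | n n' where "n \<in> N" "e = {n, v}" "n' \<in> N" "f = {n', v}"
      unfolding C' by blast
    then show ?thesis
    proof cases
      case 1
      then show ?thesis using K0 by simp
    next
      case 2
      then show ?thesis using K0[OF 0] by simp
    next
      case (3 n)
      then have "e \<union> f = insert v {n}" by auto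
      then show ?thesis using K0[OF n] 3 by simp
    next
      case (4 n)
      then have "e \<union> f = insert v (insert n f)" by auto
      then show ?thesis using K1 4 by simp
    next
      case (5 n)
      then have "e \<union> f = insert v {n}" by auto
      then show ?thesis using K0[OF n] 5 by simp
    next
      case (6 n n')
      then have "e \<union> f = insert v (insert n {n'})" by auto
      then show ?thesis using K1[OF n] 6 by simp
    qed
  qed
  show "?D' \<subseteq> ?D \<union> insert v ` ?K"
  proof
    fix \<sigma> assume "\<sigma> \<in> ?D'"
    then obtain e f where ef: "\<sigma> = e \<union> f" "e \<in> ?C'" "f \<in> ?C'" unfolding edge_pair_complex_def by blast
    show "\<sigma> \<in> ?D \<union> insert v ` ?K"
    proof (cases "e \<in> ?C \<and> f \<in> ?C")
      case True
      then show ?thesis using ef(1) unfolding edge_pair_complex_def by blast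
    next
      case False
      then consider "e \<in> insert {v} ((\<lambda>n. {n, v}) ` N)" | "f \<in> insert {v} ((\<lambda>n. {n, v}) ` N)"
        using ef(2,3) C' by blast
      then show ?thesis
      proof cases
        case 1
        then show ?thesis using half[OF 1 ef(3)] ef(1) by simp
      next
        case 2
        then show ?thesis using half[OF 2 ef(2)] ef(1) by (simp add: Un_commute)
      qed
    qed
  qed
  have D'I: "e \<union> f \<in> ?D'" if "e \<in> ?C'" "f \<in> ?C'" for e f using that unfolding edge_pair_complex_def by blast
  have "?D \<subseteq> ?D'" unfolding edge_pair_complex_def C' by blast
  moreover have "insert v f \<in> ?D'" if "f \<in> ?C" for f using D'I[of "{v}" f] that unfolding C' by simp
  moreover have "insert v (insert n f) \<in> ?D'" if "f \<in> ?C" "n \<in> N" for f n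
  proof -
    have "{n, v} \<union> f \<in> ?D'" using that by (intro D'I) (auto simp: C')
    then show ?thesis by (simp add: insert_commute)
  qed
  ultimately show "?D \<union> insert v ` ?K \<subseteq> ?D'" by blast
qed

text \<open>A simplex of the second cone outside the tree complex contains \<open>w\<close> and is
  not a simplex of the graph, as all edges at \<open>w\<close> are in the tree. If it also lies in
  the first cone, it contains \<open>u\<close>, and a third vertex is a common neighbour of
  \<open>u\<close> and \<open>w\<close>, hence equals \<open>x\<close>.\<close>

lemma square_link_intersection:
  assumes E: "\<And>e. e \<in> E \<Longrightarrow> e \<subseteq> V \<and> card e = 2" and T: "T \<subseteq> E"
    and uw: "u \<in> V" "w \<in> V" "u \<noteq> w"
    and x: "{u, x} \<in> T" "{w, x} \<in> E" "\<And>y. {u, y} \<in> E \<Longrightarrow> {w, y} \<in> E \<Longrightarrow> y = x"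
    and star: "\<And>y. {w, y} \<in> E \<Longrightarrow> {w, y} \<in> T"
  shows "(graph_complex V E \<union> insert u ` graph_complex V E) \<inter> (graph_complex V T \<union> insert w ` graph_complex V T)
    = graph_complex V T \<union> Pow {u, w, x}"
    (is "?A \<inter> ?B = ?CT \<union> _")
proof
  let ?C = "graph_complex V E"
  have edge: "\<exists>y. e = {p, y} \<and> y \<noteq> p" if "e \<in> E" "p \<in> e" for e p
    using E[OF that(1)] that(2) by (auto simp: card_2_iff)
  have CTC: "?CT \<subseteq> ?C" using T by (auto simp: graph_complex_def)
  have starC: "\<sigma> \<in> ?CT" if s: "\<sigma> \<in> ?C" "w \<in> \<sigma>" for \<sigma>
  proof (cases "\<sigma> \<in> E")
    case True
    then obtain y where "\<sigma> = {w, y}" using edge s(2) by blast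
    then show ?thesis using star True by (auto simp: graph_complex_def)
  next
    case False
    then show ?thesis using s by (auto simp: graph_complex_def)
  qed
  show "?A \<inter> ?B \<subseteq> ?CT \<union> Pow {u, w, x}"
  proof
    fix \<sigma> assume s: "\<sigma> \<in> ?A \<inter> ?B"
    show "\<sigma> \<in> ?CT \<union> Pow {u, w, x}"
    proof (cases "\<sigma> \<in> ?CT")
      case False
      then obtain t where t: "t \<in> ?CT" "\<sigma> = insert w t" using s by blast
      have wt: "w \<notin> t" using False t by (auto simp: insert_absorb)
      have "\<sigma> \<notin> ?C" using starC[of \<sigma>] False t(2) by blast
      then obtain f where f: "f \<in> ?C" "\<sigma> = insert u f" using s by blast
      have uf: "u \<notin> f" using \<open>\<sigma> \<notin> ?C\<close> f by (auto simp: insert_absorb)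
      have eq: "insert w t = insert u f" using t(2) f(2) by simp
      have "w \<in> insert u f" using insertI1[of w t] unfolding eq .
      moreover have "u \<in> insert w t" using insertI1[of u f] unfolding eq[symmetric] .
      ultimately have "w \<in> f" "u \<in> t" using uw(3) by simp_all
      show ?thesis
      proof (cases "f \<in> E")
        case True
        then obtain y where y: "f = {w, y}" "y \<noteq> w" using edge \<open>w \<in> f\<close> by blast
        have "y \<noteq> u" using y uf by blast
        have "insert w t = {u, w, y}" using t(2) f(2) y(1) by simp
        then have ty: "t = {u, y}" using wt y(2) uw(3) by auto
        then have "t \<in> E" using t(1) CTC \<open>y \<noteq> u\<close> by (auto simp: graph_complex_def)
        then have "y = x" using x(3) True y(1) ty by simp
        then show ?thesis using f(2) y(1) by simp
      next
        case False
        then have "f = {w}" using f(1) \<open>w \<in> f\<close> by (auto simp: graph_complex_def)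
        then show ?thesis using f(2) by simp
      qed
    qed simp
  qed
  have xV: "x \<in> V" using E[OF x(2)] by simp
  have "?CT \<subseteq> ?A \<inter> ?B" using CTC by blast
  moreover have "\<sigma> \<in> ?A \<inter> ?B" if "\<sigma> \<in> Pow {u, w, x}" for \<sigma>
  proof -
    have base: "{} \<in> ?CT" "{u} \<in> ?CT" "{w} \<in> ?CT" "{x} \<in> ?CT" "{u, x} \<in> ?CT" "{w, x} \<in> ?CT"
      using uw xV x(1) star[OF x(2)] by (auto simp: graph_complex_def)
    have "\<sigma> \<in> {{}, {u}, {w}, {x}, {u, x}, {w, x}} \<or> \<sigma> = insert u {w} \<or> \<sigma> = insert u {w, x}"
      using that by (auto simp: Pow_insert)
    then show ?thesis
    proof (elim disjE)
      assume "\<sigma> \<in> {{}, {u}, {w}, {x}, {u, x}, {w, x}}"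
      then show ?thesis using base CTC by blast
    next
      assume s: "\<sigma> = insert u {w}"
      then have "\<sigma> = insert w {u}" by blast
      then show ?thesis using s base CTC by blast
    next
      assume s: "\<sigma> = insert u {w, x}"
      then have "\<sigma> = insert w {u, x}" by blast
      then show ?thesis using s base CTC by blast
    qed
  qed
  ultimately show "?CT \<union> Pow {u, w, x} \<subseteq> ?A \<inter> ?B" by blast
qed

text \<open>Both requirements on the tree secure the count. As all edges at \<open>w\<close> are in
  \<open>T\<close>, a missing edge \<open>e\<close> avoids \<open>w\<close>, so
  \<open>insert w e\<close> has three vertices. It could lie in the cone with apex \<open>u\<close>
  only as \<open>{u, w, x}\<close>, and then \<open>e\<close> would be \<open>{u, x}\<close>, which
  belongs to \<open>T\<close>.\<close>

lemma square_link_difference: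
  assumes E: "\<And>e. e \<in> E \<Longrightarrow> e \<subseteq> V \<and> card e = 2" and T: "T \<subseteq> E" and fin: "finite V"
    and uw: "u \<noteq> w"
    and x: "{u, x} \<in> T" "\<And>y. {u, y} \<in> E \<Longrightarrow> {w, y} \<in> E \<Longrightarrow> y = x"
    and star: "\<And>y. {w, y} \<in> E \<Longrightarrow> {w, y} \<in> T"
  shows "(graph_complex V E \<union> insert u ` graph_complex V E \<union> insert w ` graph_complex V E)
      - ((graph_complex V E \<union> insert u ` graph_complex V E) \<union> (graph_complex V T \<union> insert w ` graph_complex V T))
    = insert w ` (E - T)" (is "?Lk - (?A \<union> ?B) = _")
    and "\<And>e. e \<in> E - T \<Longrightarrow> w \<notin> e"
proof -
  let ?C = "graph_complex V E" and ?CT = "graph_complex V T"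
  have edge: "\<exists>y. e = {p, y} \<and> y \<noteq> p" if "e \<in> E" "p \<in> e" for e p
    using E[OF that(1)] that(2) by (auto simp: card_2_iff)
  show we: "w \<notin> e" if "e \<in> E - T" for e using edge[of e w] star that by blast
  have cC: "card \<sigma> \<le> 2" "finite \<sigma>" if "\<sigma> \<in> ?C" for \<sigma>
    using that E finite_subset[OF _ fin] by (auto simp: graph_complex_def)
  have CTC: "?CT \<subseteq> ?C" using T by (auto simp: graph_complex_def)
  have CE: "\<sigma> \<in> E" if "\<sigma> \<in> ?C" "card \<sigma> = 2" for \<sigma> using that by (auto simp: graph_complex_def)
  show "?Lk - (?A \<union> ?B) = insert w ` (E - T)"
  proof
    show "?Lk - (?A \<union> ?B) \<subseteq> insert w ` (E - T)" by (auto simp: graph_complex_def)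
    show "insert w ` (E - T) \<subseteq> ?Lk - (?A \<union> ?B)"
    proof (rule image_subsetI)
      fix e assume e: "e \<in> E - T"
      have c3: "card (insert w e) = 3" using we[OF e] E[of e] e finite_subset[OF _ fin] by auto
      have "insert w e \<notin> ?C" using cC c3 by fastforce
      moreover have "insert w e \<notin> insert u ` ?C"
      proof
        assume "insert w e \<in> insert u ` ?C"
        then obtain g where g: "g \<in> ?C" "insert w e = insert u g" by blast
        have "w \<in> insert u g" using insertI1[of w e] unfolding g(2) .
        moreover have "u \<in> insert w e" using insertI1[of u g] unfolding g(2)[symmetric] .
        ultimately have "w \<in> g" "u \<in> e" using uw by simp_all
        have "card g = 2" using cC[OF g(1)] c3 g(2) card_insert_le_m1[of 3 g u]
          by (metis One_nat_def Suc_1 card_insert_if le_antisym not_less_eq_eq numeral_3_eq_3 order_refl)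
        then have "g \<in> E" using g(1) CE by blast
        obtain y where y: "e = {u, y}" "y \<noteq> u" using edge[of e u] e \<open>u \<in> e\<close> by blast
        obtain z where z: "g = {w, z}" "z \<noteq> w" using edge[of g w] \<open>g \<in> E\<close> \<open>w \<in> g\<close> by blast
        have "y \<noteq> w" using we[OF e] y by blast
        then have "y = z" using g(2) y z by auto
        then have "y = x" using x(2) e y z \<open>g \<in> E\<close> by auto
        then show False using e x(1) y by simp
      qed
      moreover have "insert w e \<notin> insert w ` ?CT"
      proof
        assume "insert w e \<in> insert w ` ?CT"
        then obtain t where t: "t \<in> ?CT" "insert w e = insert w t" by blast
        have "w \<notin> t" using c3 t cC(1)[of t] CTC by (auto simp: insert_absorb)
        then have "t = e" using t(2) insert_ident[OF we[OF e], of t] by simp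
        then show False using t(1) e E[of e] by (auto simp: graph_complex_def)
      qed
      moreover have "insert w e \<in> insert w ` ?C" using e by (auto simp: graph_complex_def)
      ultimately show "insert w e \<in> ?Lk - (?A \<union> ?B)" using CTC by blast
    qed
  qed
qed

text \<open>The induction step shared by both growth rules: a contractible part \<open>K\<close> of
  the link is coned off, and each simplex of the link left out gives one discarded simplex through
  \<open>v\<close>.\<close>

lemma edge_pair_complex_attach:
  fixes V :: "'a set"
  assumes E: "\<And>e. e \<in> E \<Longrightarrow> e \<subseteq> V \<and> card e = 2" and N: "N \<subseteq> V" and v: "v \<notin> V" "v \<in> U"
    and L: "cone_glued U 4 L" "L \<subseteq> edge_pair_complex V E" "\<And>\<sigma>. \<sigma> \<in> edge_pair_complex V E - L \<Longrightarrow> card \<sigma> = 4"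
  defines "Lk \<equiv> graph_complex V E \<union> (\<Union>n\<in>N. insert n ` graph_complex V E)"
    and "D' \<equiv> edge_pair_complex (insert v V) ((\<lambda>n. {n, v}) ` N \<union> E)"
  assumes K: "cone_glued U 4 K" "K \<subseteq> Lk" "{} \<in> K"
  shows "cone_glued U 4 (L \<union> insert v ` K)" "L \<union> insert v ` K \<subseteq> D'"
    "D' - (L \<union> insert v ` K) = (edge_pair_complex V E - L) \<union> insert v ` (Lk - K)"
    "\<And>\<sigma>. \<sigma> \<in> edge_pair_complex V E \<Longrightarrow> v \<notin> \<sigma>" "\<And>\<sigma>. \<sigma> \<in> Lk \<Longrightarrow> v \<notin> \<sigma>"
proof -
  let ?C = "graph_complex V E" and ?D = "edge_pair_complex V E"
  have D': "D' = ?D \<union> insert v ` Lk" unfolding D'_def Lk_def using N by (rule edge_pair_complex_insert)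
  have C: "\<sigma> \<subseteq> V" "card \<sigma> \<le> 2" if "\<sigma> \<in> ?C" for \<sigma> using that E by (auto simp: graph_complex_def)
  show vD: "v \<notin> \<sigma>" if "\<sigma> \<in> ?D" for \<sigma>
  proof -
    have "\<sigma> \<subseteq> V" using that C(1) unfolding edge_pair_complex_def by blast
    then show ?thesis using v by blast
  qed
  show vLk: "v \<notin> \<sigma>" if "\<sigma> \<in> Lk" for \<sigma>
  proof -
    have "\<sigma> \<subseteq> V" using that C(1) N unfolding Lk_def by blast
    then show ?thesis using v by blast
  qed
  have cLk: "card \<sigma> \<le> 3" if s: "\<sigma> \<in> Lk" for \<sigma>
  proof -
    obtain f n where f: "f \<in> ?C" "\<sigma> = f \<or> \<sigma> = insert n f" using s unfolding Lk_def by blast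
    have "card \<sigma> \<le> card f + 1" using f(2) card_insert_le_m1[of "card f + 1" f n] by auto
    then show ?thesis using C(2)[OF f(1)] by simp
  qed
  have "Lk \<subseteq> ?D"
  proof
    fix \<sigma> assume "\<sigma> \<in> Lk"
    then consider "\<sigma> \<in> ?C" | n f where "n \<in> N" "f \<in> ?C" "\<sigma> = insert n f" unfolding Lk_def by blast
    then show "\<sigma> \<in> ?D"
    proof cases
      case 1
      have "\<sigma> = \<sigma> \<union> {}" "{} \<in> ?C" by (simp_all add: graph_complex_def)
      then show ?thesis using 1 unfolding edge_pair_complex_def by blast
    next
      case 2
      have "\<sigma> = {n} \<union> f" "{n} \<in> ?C" using 2 N by (auto simp: graph_complex_def)
      then show ?thesis using 2 unfolding edge_pair_complex_def by blast
    qed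
  qed
  \<comment> \<open>Simplices of the link have at most three vertices, so none of them is among the
    four-element sets missing from \<open>L\<close>.\<close>
  then have KL: "K \<subseteq> L" using K(2) cLk L(3) by fastforce
  show "cone_glued U 4 (L \<union> insert v ` K)"
  proof (rule cone_glued_attach[OF L(1) K(1) KL _ K(3) v(2)])
    show "card \<sigma> < 4" if "\<sigma> \<in> K" for \<sigma> using cLk[of \<sigma>] K(2) that by force
    show "v \<notin> \<sigma>" if "\<sigma> \<in> L" for \<sigma> using vD L(2) that by blast
  qed
  show "L \<union> insert v ` K \<subseteq> D'" unfolding D' using L(2) K(2) by blast
  have "inj_on (insert v) Lk"
  proof (rule inj_onI)
    fix \<sigma> \<kappa> assume "\<sigma> \<in> Lk" "\<kappa> \<in> Lk" "insert v \<sigma> = insert v \<kappa>"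
    then show "\<sigma> = \<kappa>" using insert_ident[OF vLk vLk] by blast
  qed
  then have 1: "insert v ` Lk - insert v ` K = insert v ` (Lk - K)"
    using inj_on_image_set_diff[of "insert v" Lk Lk K] K(2) by simp
  have 2: "?D \<inter> insert v ` Lk = {}" by (auto dest: vD)
  have "D' - (L \<union> insert v ` K) = (?D - L) \<union> (insert v ` Lk - insert v ` K)"
    unfolding D' using 2 L(2) K(2) by blast
  then show "D' - (L \<union> insert v ` K) = (?D - L) \<union> insert v ` (Lk - K)" unfolding 1 .
qed

section \<open>Counting the discarded simplices\<close>

lemma cone_glued_cone_over_graph:
  assumes "V \<subseteq> U" "\<And>e. e \<in> E \<Longrightarrow> e \<subseteq> V \<and> card e = 2" "u \<in> U"
  shows "cone_glued U 4 (graph_complex V E \<union> insert u ` graph_complex V E)"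
proof (rule cone_glued_cone_over[OF graph_complex_simplicial[OF assms(1,2)] _ _ assms(3)])
  show "card \<sigma> < 4" if "\<sigma> \<in> graph_complex V E" for \<sigma>
    using that assms(2) by (auto simp: graph_complex_def)
qed (simp_all add: graph_complex_def)

lemma edge_pair_complex_critical:
  assumes "grown V E b" "V \<subseteq> U"
  shows "\<exists>L. cone_glued U 4 L \<and> L \<subseteq> edge_pair_complex V E \<and>
    (\<forall>\<sigma>\<in>edge_pair_complex V E - L. card \<sigma> = 4) \<and> card (edge_pair_complex V E - L) = b choose 2"
  using assms
proof induction
  case (single v)
  have "edge_pair_complex {v} {} = Pow {v}"
    by (auto simp: edge_pair_complex_def graph_complex_def Pow_insert)
  moreover have "cone_glued U 4 (Pow {v})" using single by (intro cone_glued_Pow) auto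
  ultimately show ?case by (intro exI[of _ "Pow {v}"]) (simp del: Pow_insert)
next
  case (pendant V E b v u)
  have VU: "V \<subseteq> U" "v \<in> U" using pendant.prems by auto
  note gr = grown_facts[OF pendant.hyps(1)]
  have E: "e \<subseteq> V \<and> card e = 2" if "e \<in> E" for e using gr that by blast
  obtain L where L: "cone_glued U 4 L" "L \<subseteq> edge_pair_complex V E"
      "\<And>\<sigma>. \<sigma> \<in> edge_pair_complex V E - L \<Longrightarrow> card \<sigma> = 4" "card (edge_pair_complex V E - L) = b choose 2"
    using pendant.IH[OF VU(1)] by blast
  let ?C = "graph_complex V E"
  \<comment> \<open>With a single neighbour \<open>u\<close> the link is one cone and is kept whole,
    so nothing new is discarded.\<close>
  have "cone_glued U 4 (?C \<union> insert u ` ?C)"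
    using pendant.hyps(3) VU(1) by (intro cone_glued_cone_over_graph[OF VU(1) E]) auto
  then have A: "cone_glued U 4 (?C \<union> (\<Union>n\<in>{u}. insert n ` ?C))" by simp
  have N: "{u} \<subseteq> V" using pendant.hyps(3) by simp
  have 0: "{} \<in> ?C \<union> (\<Union>n\<in>{u}. insert n ` ?C)" by (simp add: graph_complex_def)
  note att = edge_pair_complex_attach[OF E N pendant.hyps(2) VU(2) L(1-3) A order_refl 0]
  have eq: "(\<lambda>n. {n, v}) ` {u} \<union> E = insert {u, v} E" by simp
  have D: "edge_pair_complex (insert v V) (insert {u, v} E) - (L \<union> insert v ` (?C \<union> (\<Union>n\<in>{u}. insert n ` ?C)))
      = edge_pair_complex V E - L"
    using att(3) unfolding eq by simp
  show ?case
  proof (intro exI conjI)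
    show "cone_glued U 4 (L \<union> insert v ` (?C \<union> (\<Union>n\<in>{u}. insert n ` ?C)))" by (rule att(1))
    show "L \<union> insert v ` (?C \<union> (\<Union>n\<in>{u}. insert n ` ?C)) \<subseteq> edge_pair_complex (insert v V) (insert {u, v} E)"
      using att(2) unfolding eq .
  qed (unfold D, use L(3) in blast, rule L(4))
next
  case (square V E b v u w x)
  have VU: "V \<subseteq> U" "v \<in> U" using square.prems by auto
  note gr = grown_facts[OF square.hyps(1)]
  have E: "e \<subseteq> V \<and> card e = 2" if "e \<in> E" for e using gr that by blast
  obtain L where L: "cone_glued U 4 L" "L \<subseteq> edge_pair_complex V E"
      "\<And>\<sigma>. \<sigma> \<in> edge_pair_complex V E - L \<Longrightarrow> card \<sigma> = 4" "card (edge_pair_complex V E - L) = b choose 2"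
    using square.IH[OF VU(1)] by blast
  \<comment> \<open>The neighbours of \<open>w\<close>. The star at \<open>w\<close> receives
    \<open>u\<close> as a leaf at \<open>x\<close>; the result is a tree because \<open>u\<close> is
    not adjacent to \<open>w\<close>.\<close>
  define S where "S = {y. {w, y} \<in> E}"
  have SV: "S \<subseteq> V" using E unfolding S_def by blast
  have wS: "w \<notin> S" using E[of "{w}"] by (auto simp: S_def)
  have uS: "u \<notin> S" using square.hyps(8) by (simp add: S_def insert_commute)
  have finV: "finite V" using gr by blast
  have "tree (insert w S) ((\<lambda>s. {w, s}) ` S)" using finite_subset[OF SV finV] wS by (rule tree_star)
  moreover have "x \<in> S" using square.hyps(7) by (simp add: S_def)
  ultimately have tr: "tree (insert u (insert w S)) (insert {x, u} ((\<lambda>s. {w, s}) ` S))"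
    using square.hyps(5) uS by (intro tree.leaf) simp_all
  have sV: "insert u (insert w S) \<subseteq> V" using SV square.hyps(3,4) by blast
  have sE: "insert {x, u} ((\<lambda>s. {w, s}) ` S) \<subseteq> E"
    using square.hyps(6) by (auto simp: S_def insert_commute)
  from tree_extends_to_spanning_tree[OF finV grown_connected[OF square.hyps(1)] tr sV sE]
  obtain T where T: "tree V T" "insert {x, u} ((\<lambda>s. {w, s}) ` S) \<subseteq> T" "T \<subseteq> E" by blast
  have star: "{w, y} \<in> T" if "{w, y} \<in> E" for y using T(2) that by (auto simp: S_def)
  have ux: "{u, x} \<in> T" using T(2) by (simp add: insert_commute)
  let ?C = "graph_complex V E" and ?CT = "graph_complex V T"
  let ?A = "?C \<union> insert u ` ?C" and ?B = "?CT \<union> insert w ` ?CT"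
  have CTC: "?CT \<subseteq> ?C" using T(3) by (auto simp: graph_complex_def)
  have uwU: "u \<in> U" "w \<in> U" using square.hyps(3,4) VU by auto
  have TE: "e \<subseteq> V \<and> card e = 2" if "e \<in> T" for e using E T(3) that by blast
  have "cone_glued U 4 ?A"
    by (rule cone_glued_cone_over_graph[OF VU(1) E uwU(1)])
  moreover have "cone_glued U 4 ?B"
    by (rule cone_glued_cone_over_graph[OF VU(1) TE uwU(2)])
  moreover have "cone_glued U 4 (?A \<inter> ?B)"
  proof -
    have AB: "?A \<inter> ?B = ?CT \<union> Pow {u, w, x}"
      by (rule square_link_intersection[OF E T(3) square.hyps(3-5) ux square.hyps(7) square.hyps(9) star])
    have xV: "x \<in> V" using E[OF square.hyps(6)] by blast
    have uwT: "{u, w} \<notin> T" using square.hyps(8) T(3) by blast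
    have ne: "u \<noteq> x" "w \<noteq> x" using E[OF square.hyps(6)] E[OF square.hyps(7)] by auto
    have P: "cone_glued U 4 (Pow {u, w, x})"
      using xV uwU VU(1) by (intro cone_glued_Pow) (auto simp: card_insert_if)
    have sim: "simplicial U 4 (?CT \<inter> Pow {u, w, x})"
      by (intro simplicial_Int graph_complex_simplicial[OF VU(1) TE] cone_glued_simplicial[OF P]) simp_all
    have 1: "{x} \<in> ?CT" "insert x {u} \<in> ?CT" "insert x {w} \<in> ?CT"
      using xV ux star[OF square.hyps(7)] by (auto simp: graph_complex_def insert_commute)
    have 2: "{u, w} \<notin> ?CT" "{u, w, x} \<notin> ?CT"
      using uwT TE[of "{u, w, x}"] square.hyps(5) ne by (auto simp: graph_complex_def doubleton_eq_iff)
    \<comment> \<open>The tree meets the triangle in the path from \<open>u\<close> over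
      \<open>x\<close> to \<open>w\<close>, which is a cone with apex \<open>x\<close>.\<close>
    have "insert x \<sigma> \<in> ?CT \<inter> Pow {u, w, x}" if s: "\<sigma> \<in> ?CT \<inter> Pow {u, w, x}" for \<sigma>
    proof -
      have "\<sigma> \<in> Pow {u, w, x}" "\<sigma> \<noteq> {u, w}" "\<sigma> \<noteq> {u, w, x}" using s 2 by auto
      then have "\<sigma> \<in> {{}, {x}, {u}, {w}, {u, x}, {w, x}}"
        by (auto simp: Pow_insert insert_commute)
      then have "insert x \<sigma> \<in> {{x}, insert x {u}, insert x {w}}" by auto
      moreover have "\<forall>\<rho>\<in>{{x}, insert x {u}, insert x {w}}. \<rho> \<in> ?CT \<inter> Pow {u, w, x}" using 1 by simp
      ultimately show ?thesis by (rule bspec[rotated])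
    qed
    moreover have "?CT \<inter> Pow {u, w, x} \<noteq> {}" using 1(1) by blast
    ultimately have "cone_glued U 4 (?CT \<inter> Pow {u, w, x})"
      using cone_glued.cone[OF sim, of x] by blast
    moreover have "cone_glued U 4 ?CT" using T(1) VU(1) by (intro tree_cone_glued) auto
    ultimately show ?thesis unfolding AB using P by (intro cone_glued.glue)
  qed
  ultimately have cg: "cone_glued U 4 (?A \<union> ?B)" by (rule cone_glued.glue)
  have N: "{u, w} \<subseteq> V" using square.hyps(3,4) by simp
  have sub: "?A \<union> ?B \<subseteq> ?C \<union> (\<Union>n\<in>{u, w}. insert n ` ?C)" using CTC by auto
  have 0: "{} \<in> ?A \<union> ?B" by (simp add: graph_complex_def)
  note att = edge_pair_complex_attach[OF E N square.hyps(2) VU(2) L(1-3) cg sub 0]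
  note diff = square_link_difference[OF E T(3) _ square.hyps(5) ux square.hyps(9) star]
  have Lk: "?C \<union> (\<Union>n\<in>{u, w}. insert n ` ?C) = ?C \<union> insert u ` ?C \<union> insert w ` ?C" by auto
  have we: "w \<notin> e" if "e \<in> E - T" for e using diff(2) gr that by blast
  have ve: "v \<notin> e" "finite e" if "e \<in> E" for e
    using E[OF that] square.hyps(2) gr finite_subset by blast+
  let ?new = "(\<lambda>e. insert v (insert w e)) ` (E - T)"
  have D: "edge_pair_complex (insert v V) (insert {u, v} (insert {w, v} E)) - (L \<union> insert v ` (?A \<union> ?B))
      = (edge_pair_complex V E - L) \<union> ?new"
    using att(3) diff(1) gr unfolding Lk by (simp add: image_image)
  have vw: "v \<noteq> w" using square.hyps(2,4) by blast
  have c4: "card \<sigma> = 4" if "\<sigma> \<in> ?new" for \<sigma>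
    using that we ve E vw by auto
  have "inj_on (\<lambda>e. insert v (insert w e)) (E - T)"
  proof (rule inj_onI)
    fix e f assume e: "e \<in> E - T" and f: "f \<in> E - T" and eq: "insert v (insert w e) = insert v (insert w f)"
    have "e = insert v (insert w e) - {v, w}" using we[OF e] ve(1)[of e] e by blast
    also have "\<dots> = f" unfolding eq using we[OF f] ve(1)[of f] f by blast
    finally show "e = f" .
  qed
  then have "card ?new = card (E - T)" by (rule card_image)
  also have "\<dots> = card E - card T" using T(3) gr finite_subset by (intro card_Diff_subset) auto
  \<comment> \<open>The graph has \<open>card V + b - 1\<close> edges and the tree has
    \<open>card V - 1\<close>.\<close>
  also have "\<dots> = b" using gr tree_facts[OF T(1)] by auto
  finally have cn: "card ?new = b" .
  have "finite (edge_pair_complex V E)"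
  proof (rule finite_subset)
    show "edge_pair_complex V E \<subseteq> Pow V"
      using E unfolding edge_pair_complex_def by (auto simp: graph_complex_def)
  qed (use gr in simp)
  moreover have "(edge_pair_complex V E - L) \<inter> ?new = {}" using att(4) by blast
  ultimately have "card ((edge_pair_complex V E - L) \<union> ?new) = (b choose 2) + b"
    using L(4) cn gr by (subst card_Un_disjoint) auto
  also have "\<dots> = Suc b choose 2" by (simp add: numeral_2_eq_2)
  finally have cD: "card ((edge_pair_complex V E - L) \<union> ?new) = Suc b choose 2" .
  have eq: "(\<lambda>n. {n, v}) ` {u, w} \<union> E = insert {u, v} (insert {w, v} E)" by auto
  show ?case
  proof (intro exI conjI)
    show "cone_glued U 4 (L \<union> insert v ` (?A \<union> ?B))" by (rule att(1))
    show "L \<union> insert v ` (?A \<union> ?B) \<subseteq> edge_pair_complex (insert v V) (insert {u, v} (insert {w, v} E))"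
      using att(2) unfolding eq .
    show "\<forall>\<sigma>\<in>edge_pair_complex (insert v V) (insert {u, v} (insert {w, v} E)) - (L \<union> insert v ` (?A \<union> ?B)). card \<sigma> = 4"
      unfolding D using L(3) c4 by blast
    show "card (edge_pair_complex (insert v V) (insert {u, v} (insert {w, v} E)) - (L \<union> insert v ` (?A \<union> ?B))) = Suc b choose 2"
      unfolding D by (rule cD)
  qed
qed

lemma graph_complex_critical:
  assumes "grown V E b" "V \<subseteq> U"
  shows "\<exists>L. cone_glued U 4 L \<and> L \<subseteq> graph_complex V E \<and>
    (\<forall>\<sigma>\<in>graph_complex V E - L. card \<sigma> = 2) \<and> card (graph_complex V E - L) = b"
proof -
  note gr = grown_facts[OF assms(1)]
  obtain v where "v \<in> V" using gr by blast
  then obtain T where T: "tree V T" "T \<subseteq> E"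
    using tree_extends_to_spanning_tree[OF _ grown_connected[OF assms(1)] tree.single] gr by blast
  have eq: "graph_complex V E - graph_complex V T = E - T"
    using gr tree_facts[OF T(1)] by (auto simp: graph_complex_def)
  have "card (E - T) = b"
    using gr tree_facts[OF T(1)] T(2) by (subst card_Diff_subset) auto
  moreover have "cone_glued U 4 (graph_complex V T)" using T(1) assms(2) by (intro tree_cone_glued) auto
  moreover have "graph_complex V T \<subseteq> graph_complex V E" using T(2) by (auto simp: graph_complex_def)
  ultimately show ?thesis
    using gr by (intro exI[of _ "graph_complex V T"] conjI) (auto simp: eq)
qed

section \<open>Bipartite graphs and grids\<close>

lemma robust_clique_complexD:
  assumes "W \<in> robust_clique_complex k (V, E)"
  shows "W \<subseteq> V" "\<And>S. \<lbrakk>S \<subseteq> W; card S = k\<rbrakk> \<Longrightarrow> \<exists>u\<in>S. \<exists>v\<in>S. {u, v} \<in> E"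
proof -
  show sub: "W \<subseteq> V" using assms by (simp add: robust_clique_complex_def)
  fix S assume S: "S \<subseteq> W" "card S = k"
  then have "\<not> independent_set (V, E) S" using assms unfolding robust_clique_complex_def by blast
  moreover have "S \<subseteq> V" using S(1) sub by simp
  ultimately show "\<exists>u\<in>S. \<exists>v\<in>S. {u, v} \<in> E" by (simp add: independent_set_def)
qed

lemma robust_clique_complexI:
  assumes "W \<subseteq> V" "\<And>S. \<lbrakk>S \<subseteq> W; card S = k; \<forall>u\<in>S. \<forall>v\<in>S. {u, v} \<notin> E\<rbrakk> \<Longrightarrow> False"
  shows "W \<in> robust_clique_complex k (V, E)"
proof -
  have False if "S \<subseteq> W" "independent_set (V, E) S" "card S = k" for S
    using that by (intro assms(2)[of S]) (simp_all add: independent_set_def)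
  then show ?thesis using assms(1) unfolding robust_clique_complex_def by auto
qed

lemma independent_in_graph_complex:
  assumes E: "\<And>e. e \<in> E \<Longrightarrow> card e = 2" and e: "e \<in> graph_complex V E"
    and S: "\<forall>u\<in>S. \<forall>v\<in>S. {u, v} \<notin> E"
  shows "card (S \<inter> e) \<le> 1"
proof (cases "e \<in> E")
  case True
  then obtain p q where pq: "e = {p, q}" using E by (metis card_2_iff)
  then have "p \<notin> S \<or> q \<notin> S" using S True by blast
  then have "S \<inter> e \<subseteq> {p} \<or> S \<inter> e \<subseteq> {q}" using pq by blast
  then show ?thesis by (elim disjE) (auto dest!: card_mono[rotated])
next
  case False
  then obtain v where "e \<subseteq> {v}" using e unfolding graph_complex_def by blast
  then have "S \<inter> e \<subseteq> {v}" by blast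
  then show ?thesis by (auto dest!: card_mono[rotated])
qed

lemma card_le_2_cases:
  assumes "finite X" "card X \<le> 2"
  obtains "X = {}" | a where "X = {a}" | a a' where "a \<noteq> a'" "X = {a, a'}"
proof -
  consider "card X = 0" | "card X = 1" | "card X = 2" using assms(2) by linarith
  then show ?thesis
  proof cases
    case 1
    then show ?thesis using assms(1) that(1) by simp
  next
    case 2
    then show ?thesis using that(2) by (auto simp: card_1_singleton_iff)
  next
    case 3
    then show ?thesis using that(3) by (auto simp: card_2_iff)
  qed
qed

locale bipartite_graph =
  fixes V :: "'a set" and E :: "'a set set" and c :: "'a \<Rightarrow> bool"
  assumes finite_V: "finite V" and edges: "\<And>e. e \<in> E \<Longrightarrow> e \<subseteq> V \<and> card e = 2"
    and colour: "\<And>p q. {p, q} \<in> E \<Longrightarrow> c p \<noteq> c q"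
begin

text \<open>A colour class is independent, so any \<open>Suc k\<close> of its vertices would form a
  forbidden set.\<close>

lemma colour_class_small:
  assumes W: "W \<in> robust_clique_complex (Suc k) (V, E)"
  shows "card {p \<in> W. c p = b} \<le> k" "finite {p \<in> W. c p = b}"
proof -
  show fin: "finite {p \<in> W. c p = b}"
    using finite_subset[OF robust_clique_complexD(1)[OF W] finite_V] by simp
  show "card {p \<in> W. c p = b} \<le> k"
  proof (rule ccontr)
    assume "\<not> card {p \<in> W. c p = b} \<le> k"
    then obtain S where S: "S \<subseteq> {p \<in> W. c p = b}" "card S = Suc k"
      by (metis obtain_subset_with_card_n not_less_eq_eq)
    then have "S \<subseteq> W" by blast
    then obtain u v where "u \<in> S" "v \<in> S" "{u, v} \<in> E" using robust_clique_complexD(2)[OF W _ S(2)] by blast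
    then have "c u = b" "c v = b" using S(1) by auto
    then show False using colour[OF \<open>{u, v} \<in> E\<close>] by simp
  qed
qed

lemma colour_split: "W = {p \<in> W. c p = True} \<union> {p \<in> W. c p = False}"
  by auto

lemma robust_clique_complex_2: "robust_clique_complex 2 (V, E) = graph_complex V E"
proof
  show "robust_clique_complex 2 (V, E) \<subseteq> graph_complex V E"
  proof
    fix W assume W: "W \<in> robust_clique_complex 2 (V, E)"
    then have W': "W \<in> robust_clique_complex (Suc 1) (V, E)" by (simp add: numeral_2_eq_2)
    have fin: "finite W" using finite_subset[OF robust_clique_complexD(1)[OF W] finite_V] .
    have "card W \<le> card {p \<in> W. c p = True} + card {p \<in> W. c p = False}"
      by (subst colour_split) (rule card_Un_le)
    then have "card W \<le> 2" using colour_class_small(1)[OF W', of True] colour_class_small(1)[OF W', of False] by simp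
    then consider p where "W \<subseteq> {p}" | p q where "p \<noteq> q" "W = {p, q}"
      by (cases rule: card_le_2_cases[OF fin]) auto
    then show "W \<in> graph_complex V E"
    proof cases
      case 1
      then show ?thesis using robust_clique_complexD(1)[OF W] by (auto simp: graph_complex_def subset_singleton_iff)
    next
      case 2
      have "card W = 2" using 2 by simp
      then obtain u v where "u \<in> W" "v \<in> W" "{u, v} \<in> E"
        using robust_clique_complexD(2)[OF W order_refl] by blast
      moreover have "u \<noteq> v" using edges[OF \<open>{u, v} \<in> E\<close>] by auto
      ultimately have "W \<in> E" using 2 by (auto simp: insert_commute)
      then show ?thesis by (simp add: graph_complex_def)
    qed
  qed
  show "graph_complex V E \<subseteq> robust_clique_complex 2 (V, E)"
  proof
    fix W assume W: "W \<in> graph_complex V E"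
    show "W \<in> robust_clique_complex 2 (V, E)"
    proof (rule robust_clique_complexI)
      show "W \<subseteq> V" using W edges by (auto simp: graph_complex_def)
      fix S assume "S \<subseteq> W" "card S = 2" "\<forall>u\<in>S. \<forall>v\<in>S. {u, v} \<notin> E"
      then show False using independent_in_graph_complex[OF _ W, of S] edges by (simp add: Int_absorb2)
    qed
  qed
qed

lemma robust_clique_complex_3: "robust_clique_complex 3 (V, E) = edge_pair_complex V E"
proof
  show "edge_pair_complex V E \<subseteq> robust_clique_complex 3 (V, E)"
  proof
    fix W assume "W \<in> edge_pair_complex V E"
    then obtain e f where W: "W = e \<union> f" "e \<in> graph_complex V E" "f \<in> graph_complex V E"
      unfolding edge_pair_complex_def by blast
    show "W \<in> robust_clique_complex 3 (V, E)"
    proof (rule robust_clique_complexI)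
      show "W \<subseteq> V" using W edges by (auto simp: graph_complex_def)
      fix S assume S: "S \<subseteq> W" "card S = 3" "\<forall>u\<in>S. \<forall>v\<in>S. {u, v} \<notin> E"
      have "S = (S \<inter> e) \<union> (S \<inter> f)" using S(1) W(1) by blast
      then have "card S \<le> card (S \<inter> e) + card (S \<inter> f)" by (metis card_Un_le)
      also have "\<dots> \<le> 1 + 1"
        by (intro add_mono independent_in_graph_complex[OF _ W(2) S(3)] independent_in_graph_complex[OF _ W(3) S(3)])
           (simp_all add: edges)
      finally show False using S(2) by simp
    qed
  qed
  show "robust_clique_complex 3 (V, E) \<subseteq> edge_pair_complex V E"
  proof
    fix W assume W: "W \<in> robust_clique_complex 3 (V, E)"
    then have W': "W \<in> robust_clique_complex (Suc 2) (V, E)" by (simp add: numeral_3_eq_3 numeral_2_eq_2)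
    note WV = robust_clique_complexD(1)[OF W]
    have V1: "{p} \<in> graph_complex V E" if "p \<in> W" for p using that WV by (auto simp: graph_complex_def)
    have V0: "{} \<in> graph_complex V E" by (simp add: graph_complex_def)
    have V2: "e \<in> graph_complex V E" if "e \<in> E" for e using that by (simp add: graph_complex_def)
    have pairI: "\<sigma> \<in> edge_pair_complex V E" if "e \<in> graph_complex V E" "f \<in> graph_complex V E" "\<sigma> = e \<union> f" for \<sigma> e f
      using that unfolding edge_pair_complex_def by blast
    have loop: "{p, p} \<notin> E" for p using colour by blast
    \<comment> \<open>The three vertices are not independent, and \<open>p\<close> and
      \<open>q\<close> have the same colour, so an edge among them must use
      \<open>r\<close>.\<close>
    have tri: "{p, r} \<in> E \<or> {q, r} \<in> E"
      if "p \<in> W" "q \<in> W" "r \<in> W" "p \<noteq> q" "c p = c q" "c r \<noteq> c p" for p q r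
    proof -
      have "r \<noteq> p" "r \<noteq> q" using that(5,6) by auto
      then have "card {p, q, r} = 3" "{p, q, r} \<subseteq> W" using that(1-4) by auto
      then obtain u v where uv: "u \<in> {p, q, r}" "v \<in> {p, q, r}" "{u, v} \<in> E"
        using robust_clique_complexD(2)[OF W] by blast
      then have "c u \<noteq> c v" using colour by blast
      then show ?thesis using uv that by (auto simp: insert_commute)
    qed
    define X where "X = {p \<in> W. c p = True}"
    define Y where "Y = {p \<in> W. c p = False}"
    have WXY: "W = X \<union> Y" unfolding X_def Y_def by (rule colour_split)
    have X: "finite X" "card X \<le> 2" "\<And>p. p \<in> X \<Longrightarrow> p \<in> W \<and> c p"
      and Y: "finite Y" "card Y \<le> 2" "\<And>p. p \<in> Y \<Longrightarrow> p \<in> W \<and> \<not> c p"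
      using colour_class_small[OF W', of True] colour_class_small[OF W', of False] unfolding X_def Y_def by simp_all
    have one_two: "\<sigma> \<in> edge_pair_complex V E"
      if s: "\<sigma> = {a, a', b}" and ab: "a \<in> W" "a' \<in> W" "b \<in> W" "a \<noteq> a'" "c a = c a'" "c b \<noteq> c a" for \<sigma> a a' b
    proof -
      from tri[OF ab] consider "{a, b} \<in> E" | "{a', b} \<in> E" by blast
      then show ?thesis
      proof cases
        case 1
        then show ?thesis using s ab by (intro pairI[OF V2[OF 1] V1[of a']]) auto
      next
        case 2
        then show ?thesis using s ab by (intro pairI[OF V2[OF 2] V1[of a]]) auto
      qed
    qed
    show "W \<in> edge_pair_complex V E"
    proof (cases rule: card_le_2_cases[OF X(1,2)])
      case X: 1
      show ?thesis
      proof (cases rule: card_le_2_cases[OF Y(1,2)])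
        case 1
        then show ?thesis using X WXY by (intro pairI[OF V0 V0]) auto
      next
        case (2 b)
        then show ?thesis using X WXY Y(3) by (intro pairI[OF V1[of b] V0]) auto
      next
        case (3 b b')
        then show ?thesis using X WXY Y(3) by (intro pairI[OF V1[of b] V1[of b']]) auto
      qed
    next
      case A: (2 a)
      have a: "a \<in> W" "c a" using A X(3) by auto
      show ?thesis
      proof (cases rule: card_le_2_cases[OF Y(1,2)])
        case 1
        then show ?thesis using A WXY a by (intro pairI[OF V1[of a] V0]) auto
      next
        case (2 b)
        then show ?thesis using A WXY a Y(3) by (intro pairI[OF V1[of a] V1[of b]]) auto
      next
        case (3 b b')
        have "b \<in> W" "b' \<in> W" "\<not> c b" "\<not> c b'" using 3 Y(3) by auto
        then show ?thesis using A WXY a 3 by (intro one_two[of W b b' a]) auto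
      qed
    next
      case A: (3 a a')
      have a: "a \<in> W" "c a" "a' \<in> W" "c a'" using A X(3) by auto
      show ?thesis
      proof (cases rule: card_le_2_cases[OF Y(1,2)])
        case 1
        then show ?thesis using A WXY a by (intro pairI[OF V1[of a] V1[of a']]) auto
      next
        case (2 b)
        have "b \<in> W" "\<not> c b" using 2 Y(3) by auto
        then show ?thesis using A WXY a 2 by (intro one_two[of W a a' b]) auto
      next
        case (3 b b')
        have b: "b \<in> W" "b' \<in> W" "\<not> c b" "\<not> c b'" using 3 Y(3) by auto
        have Weq: "W = {a, b} \<union> {a', b'}" "W = {a, b'} \<union> {a', b}" using A(2) 3(2) WXY by auto
        have 1: "{a, b} \<in> E \<or> {a', b} \<in> E" and 2: "{a, b'} \<in> E \<or> {a', b'} \<in> E"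
          using tri[of a a' b] tri[of a a' b'] a b A(1) by auto
        have 3: "{a, b} \<in> E \<or> {a, b'} \<in> E" and 4: "{a', b} \<in> E \<or> {a', b'} \<in> E"
          using tri[of b b' a] tri[of b b' a'] a b 3(1) by (auto simp: insert_commute)
        \<comment> \<open>Each of the four vertices has a neighbour among the two of the other
          colour; this is Hall's condition and gives a perfect matching.\<close>
        have "{a, b} \<in> E \<and> {a', b'} \<in> E \<or> {a, b'} \<in> E \<and> {a', b} \<in> E"
          using 1 2 3 4 by argo
        then show ?thesis
        proof (elim disjE conjE)
          assume "{a, b} \<in> E" "{a', b'} \<in> E"
          then show ?thesis using Weq(1) by (intro pairI[OF V2 V2])
        next
          assume "{a, b'} \<in> E" "{a', b} \<in> E"
          then show ?thesis using Weq(2) by (intro pairI[OF V2 V2])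
        qed
      qed
    qed
  qed
qed

end

section \<open>Building the grid row by row\<close>

definition grid_adjacent :: "nat \<times> nat \<Rightarrow> nat \<times> nat \<Rightarrow> bool" where
  "grid_adjacent p q \<longleftrightarrow> fst p = fst q \<and> (snd q = Suc (snd p) \<or> snd p = Suc (snd q)) \<or>
     snd p = snd q \<and> (fst q = Suc (fst p) \<or> fst p = Suc (fst q))"

text \<open>Induced subgraphs on arbitrary vertex sets, because the growth passes through partly
  filled rows.\<close>

definition grid_edges :: "(nat \<times> nat) set \<Rightarrow> (nat \<times> nat) set set" where
  "grid_edges S = {{p, q} | p q. p \<in> S \<and> q \<in> S \<and> grid_adjacent p q}"

lemma grid_adjacent_sym: "grid_adjacent p q \<longleftrightarrow> grid_adjacent q p"
  unfolding grid_adjacent_def by auto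

lemma grid_edges_iff: "{p, q} \<in> grid_edges S \<longleftrightarrow> p \<in> S \<and> q \<in> S \<and> grid_adjacent p q"
proof
  assume "{p, q} \<in> grid_edges S"
  then obtain p' q' where pq: "{p, q} = {p', q'}" "p' \<in> S" "q' \<in> S" "grid_adjacent p' q'"
    unfolding grid_edges_def by blast
  from pq(1) have "p = p' \<and> q = q' \<or> p = q' \<and> q = p'" by (simp only: doubleton_eq_iff)
  then show "p \<in> S \<and> q \<in> S \<and> grid_adjacent p q" using pq(2-4) grid_adjacent_sym[of p' q'] by auto
qed (auto simp only: grid_edges_def)

lemma grid_edges_insert:
  assumes "N = {p \<in> S. grid_adjacent p v}"
  shows "grid_edges (insert v S) = (\<lambda>p. {p, v}) ` N \<union> grid_edges S"
proof -
  have vv: "\<not> grid_adjacent v v" by (simp add: grid_adjacent_def)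
  show ?thesis
  proof
    show "grid_edges (insert v S) \<subseteq> (\<lambda>p. {p, v}) ` N \<union> grid_edges S"
    proof
      fix e assume "e \<in> grid_edges (insert v S)"
      then obtain p q where e: "e = {p, q}" "p \<in> insert v S" "q \<in> insert v S" "grid_adjacent p q"
        unfolding grid_edges_def by blast
      consider "p \<in> S" "q \<in> S" | "p = v" "q \<in> S" | "q = v" "p \<in> S" using e vv by blast
      then show "e \<in> (\<lambda>p. {p, v}) ` N \<union> grid_edges S"
      proof cases
        case 1
        then show ?thesis using e by (simp add: grid_edges_iff)
      next
        case 2
        then have "q \<in> N" "e = {q, v}" using e grid_adjacent_sym[of v q] by (simp_all add: assms insert_commute)
        then show ?thesis by simp
      next
        case 3
        then have "p \<in> N" "e = {p, v}" using e by (simp_all add: assms)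
        then show ?thesis by simp
      qed
    qed
    show "(\<lambda>p. {p, v}) ` N \<union> grid_edges S \<subseteq> grid_edges (insert v S)"
      unfolding assms grid_edges_def by blast
  qed
qed

lemma grid_graph_eq: "grid_graph m n = ({1..m} \<times> {1..n}, grid_edges ({1..m} \<times> {1..n}))"
proof -
  have "e \<in> snd (grid_graph m n) \<longleftrightarrow> e \<in> grid_edges ({1..m} \<times> {1..n})" for e
  proof
    assume "e \<in> snd (grid_graph m n)"
    then show "e \<in> grid_edges ({1..m} \<times> {1..n})"
      by (auto simp: grid_graph_def grid_edges_iff grid_adjacent_def)
  next
    assume "e \<in> grid_edges ({1..m} \<times> {1..n})"
    then obtain i j i' j' where e: "e = {(i, j), (i', j')}" "(i, j) \<in> {1..m} \<times> {1..n}" "(i', j') \<in> {1..m} \<times> {1..n}"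
      "grid_adjacent (i, j) (i', j')" unfolding grid_edges_def by auto
    then consider "i' = i" "j' = j + 1" | "i' = i" "j = j' + 1" | "j' = j" "i' = i + 1" | "j' = j" "i = i' + 1"
      unfolding grid_adjacent_def by auto
    then show "e \<in> snd (grid_graph m n)"
    proof cases
      case 1
      then have "e = {(i, j), (i, j + 1)}" "1 \<le> i \<and> i \<le> m \<and> 1 \<le> j \<and> j \<le> n - 1" using e by auto
      then show ?thesis unfolding grid_graph_def by auto
    next
      case 2
      then have "e = {(i, j'), (i, j' + 1)}" "1 \<le> i \<and> i \<le> m \<and> 1 \<le> j' \<and> j' \<le> n - 1" using e by auto
      then show ?thesis unfolding grid_graph_def by auto
    next
      case 3
      then have "e = {(i, j), (i + 1, j)}" "1 \<le> i \<and> i \<le> m - 1 \<and> 1 \<le> j \<and> j \<le> n" using e by auto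
      then show ?thesis unfolding grid_graph_def by auto
    next
      case 4
      then have "e = {(i', j), (i' + 1, j)}" "1 \<le> i' \<and> i' \<le> m - 1 \<and> 1 \<le> j \<and> j \<le> n" using e by auto
      then show ?thesis unfolding grid_graph_def by auto
    qed
  qed
  then have "snd (grid_graph m n) = grid_edges ({1..m} \<times> {1..n})" by blast
  moreover have "fst (grid_graph m n) = {1..m} \<times> {1..n}" by (simp add: grid_graph_def)
  ultimately show ?thesis by (metis prod.collapse)
qed

lemma bipartite_grid: "finite S \<Longrightarrow> bipartite_graph S (grid_edges S) (\<lambda>p. even (fst p + snd p))"
proof
  fix e assume "e \<in> grid_edges S"
  then obtain p q where "e = {p, q}" "p \<in> S" "q \<in> S" "grid_adjacent p q" unfolding grid_edges_def by blast
  moreover from this have "p \<noteq> q" by (auto simp: grid_adjacent_def)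
  ultimately show "e \<subseteq> S \<and> card e = 2" by simp
qed (auto simp: grid_edges_iff grid_adjacent_def)

text \<open>The stages of filling the grid. A complete row and an empty next row describe the same
  set, which joins the inductions over columns and over rows.\<close>

definition grid_prefix :: "nat \<Rightarrow> nat \<Rightarrow> nat \<Rightarrow> (nat \<times> nat) set" where
  "grid_prefix n i j = {1..i} \<times> {1..n} \<union> {Suc i} \<times> {1..j}"

lemma grid_prefix_Suc: "grid_prefix n i (Suc j) = insert (Suc i, Suc j) (grid_prefix n i j)"
  by (auto simp: grid_prefix_def)

lemma grid_prefix_row: "grid_prefix n i n = grid_prefix n (Suc i) 0"
  by (auto simp: grid_prefix_def le_Suc_eq)

text \<open>The first row is a path, so every vertex after the first is pendant.\<close>

lemma grown_first_row:
  "grown (grid_prefix n 0 (Suc j)) (grid_edges (grid_prefix n 0 (Suc j))) 0"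
proof (induction j)
  case 0
  have "grid_prefix n 0 (Suc 0) = {(1, 1)}" by (auto simp: grid_prefix_def)
  moreover have "grid_edges {(1, 1)} = {}" by (auto simp: grid_edges_def grid_adjacent_def)
  ultimately show ?case by (simp add: grown.single)
next
  case (Suc j)
  let ?S = "grid_prefix n 0 (Suc j)"
  have "grid_edges (insert (Suc 0, Suc (Suc j)) ?S) = (\<lambda>p. {p, (Suc 0, Suc (Suc j))}) ` {(Suc 0, Suc j)} \<union> grid_edges ?S"
    by (rule grid_edges_insert) (auto simp: grid_prefix_def grid_adjacent_def)
  then show ?case
    using grown.pendant[OF Suc, of "(Suc 0, Suc (Suc j))" "(Suc 0, Suc j)"]
    by (simp add: grid_prefix_Suc[of n 0 "Suc j"]) (simp add: grid_prefix_def)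
qed

text \<open>The first vertex hangs on its neighbour in the previous row; every later one closes a
  square with its neighbours \<open>?u\<close> and \<open>?w\<close> and the opposite corner
  \<open>?x\<close>. Hence \<open>Suc j\<close> vertices bring only \<open>j\<close>
  squares.\<close>

lemma grown_next_row:
  assumes "grown (grid_prefix n (Suc i) 0) (grid_edges (grid_prefix n (Suc i) 0)) b" "Suc j \<le> n"
  shows "grown (grid_prefix n (Suc i) (Suc j)) (grid_edges (grid_prefix n (Suc i) (Suc j))) (b + j)"
  using assms(2)
proof (induction j)
  case 0
  let ?S = "grid_prefix n (Suc i) 0"
  let ?v = "(Suc (Suc i), Suc 0)" and ?u = "(Suc i, Suc 0)"
  have N: "{?u} = {p \<in> ?S. grid_adjacent p ?v}" using 0 by (auto simp: grid_prefix_def grid_adjacent_def)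
  have "?v \<notin> ?S" "?u \<in> ?S" using 0 by (auto simp: grid_prefix_def)
  from grown.pendant[OF assms(1) this] show ?case
    unfolding grid_prefix_Suc grid_edges_insert[OF N] by simp
next
  case (Suc j)
  let ?S = "grid_prefix n (Suc i) (Suc j)"
  let ?v = "(Suc (Suc i), Suc (Suc j))" and ?u = "(Suc (Suc i), Suc j)" and ?w = "(Suc i, Suc (Suc j))"
    and ?x = "(Suc i, Suc j)"
  have gr: "grown ?S (grid_edges ?S) (b + j)" using Suc by simp
  have N: "{?u, ?w} = {p \<in> ?S. grid_adjacent p ?v}" using Suc.prems by (auto simp: grid_prefix_def grid_adjacent_def)
  have "grown (insert ?v ?S) (insert {?u, ?v} (insert {?w, ?v} (grid_edges ?S))) (Suc (b + j))"
  proof (rule grown.square[OF gr, where x = ?x])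
    \<comment> \<open>In the unbounded grid \<open>?u\<close> and \<open>?w\<close> have two common
      neighbours, \<open>?x\<close> and \<open>?v\<close>, and \<open>?v\<close> is not yet
      present.\<close>
    show "y = ?x" if "{?u, y} \<in> grid_edges ?S" "{?w, y} \<in> grid_edges ?S" for y
      using that by (cases y) (auto simp: grid_edges_iff grid_prefix_def grid_adjacent_def)
  qed (use Suc.prems in \<open>auto simp: grid_edges_iff grid_prefix_def grid_adjacent_def\<close>)
  then show ?case unfolding grid_prefix_Suc[of n "Suc i" "Suc j"] grid_edges_insert[OF N] by simp
qed

lemma grown_grid:
  assumes "1 \<le> n"
  shows "grown ({1..Suc i} \<times> {1..n}) (grid_edges ({1..Suc i} \<times> {1..n})) (i * (n - 1))"
proof -
  obtain k where n: "n = Suc k" using assms by (cases n) auto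
  have eq: "{1..Suc i} \<times> {1..n} = grid_prefix n (Suc i) 0" for i by (simp add: grid_prefix_def)
  have "grown (grid_prefix n (Suc i) 0) (grid_edges (grid_prefix n (Suc i) 0)) (i * k)"
  proof (induction i)
    case 0
    show ?case using grown_first_row[of n k] by (simp add: n[symmetric] grid_prefix_row)
  next
    case (Suc i)
    show ?case using grown_next_row[OF Suc, of k] by (simp add: n[symmetric] grid_prefix_row add.commute)
  qed
  then show ?thesis unfolding eq by (simp add: n)
qed

theorem theorem1:
  fixes m n k :: nat
  assumes "m \<ge> 2" and "n \<ge> 2" and "k \<in> {2, 3}"
  shows "geometric_realization (robust_clique_complex k (grid_graph m n))
    homotopy_equivalent_space
    wedge_of_spheres (((m - 1) * (n - 1)) choose (k - 1)) (2 * k - 3)"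
proof -
  define V where "V = {1..m} \<times> {1..n}"
  define E where "E = grid_edges V"
  have finV: "finite V" by (simp add: V_def)
  \<comment> \<open>The dimension is \<open>2 * r\<close> for \<open>r = 4\<close>, the largest
    number of vertices of a simplex for \<open>k = 3\<close>; one embedding serves both values of
    \<open>k\<close>.\<close>
  obtain p :: "nat \<times> nat \<Rightarrow> real ^ 8" where p: "\<And>S c. S \<subseteq> V \<Longrightarrow> card S \<le> CARD(8)
      \<Longrightarrow> (\<Sum>v\<in>S. c v *\<^sub>R p v) = 0 \<Longrightarrow> (\<forall>v\<in>S. c v = 0)"
    using exists_general_position[OF finV] by blast
  interpret general_position V 4 p
    by unfold_locales (use finV p in auto)
  interpret bipartite_graph V E "\<lambda>p. even (fst p + snd p)"
    unfolding E_def by (rule bipartite_grid[OF finV])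
  have G: "grid_graph m n = (V, E)" by (simp add: grid_graph_eq V_def E_def)
  have grown: "grown V E ((m - 1) * (n - 1))"
    using grown_grid[of n "m - 1"] assms(1,2) by (simp add: V_def E_def)
  have sim2: "simplicial V 4 (graph_complex V E)" by (rule graph_complex_simplicial) (use edges in auto)
  have sim3: "simplicial V 4 (edge_pair_complex V E)"
    unfolding simplicial_def
  proof (intro conjI ballI allI impI)
    fix \<sigma> assume s: "\<sigma> \<in> edge_pair_complex V E"
    then obtain e f where ef: "\<sigma> = e \<union> f" "e \<in> graph_complex V E" "f \<in> graph_complex V E"
      unfolding edge_pair_complex_def by blast
    have "e \<subseteq> V \<and> card e \<le> 2" "f \<subseteq> V \<and> card f \<le> 2" using ef(2,3) edges by (auto simp: graph_complex_def)
    then show "\<sigma> \<subseteq> V" "card \<sigma> \<le> 4" using ef(1) card_Un_le[of e f] by auto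
    \<comment> \<open>Closure under subsets is evident for robust cliques, so no case analysis of
      subsets of two edges is made.\<close>
    show "\<tau> \<in> edge_pair_complex V E" if "\<tau> \<subseteq> \<sigma>" for \<tau>
      using s that unfolding robust_clique_complex_3[symmetric] robust_clique_complex_def by blast
  qed
  from assms(3) consider "k = 2" | "k = 3" by blast
  then show ?thesis
  proof cases
    case 1
    obtain L where L: "cone_glued V 4 L" "L \<subseteq> graph_complex V E"
      "\<And>\<sigma>. \<sigma> \<in> graph_complex V E - L \<Longrightarrow> card \<sigma> = Suc 1" "card (graph_complex V E - L) = (m - 1) * (n - 1)"
      using graph_complex_critical[OF grown order_refl] by auto
    show ?thesis
      using homotopy_equivalent_wedge_of_spheres[OF sim2 L(1-3)] L(4)
      unfolding G 1 robust_clique_complex_2 by simp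
  next
    case 2
    obtain L where L: "cone_glued V 4 L" "L \<subseteq> edge_pair_complex V E"
      "\<And>\<sigma>. \<sigma> \<in> edge_pair_complex V E - L \<Longrightarrow> card \<sigma> = Suc 3"
      "card (edge_pair_complex V E - L) = ((m - 1) * (n - 1)) choose 2"
      using edge_pair_complex_critical[OF grown order_refl] by auto
    show ?thesis
      using homotopy_equivalent_wedge_of_spheres[OF sim3 L(1-3)] L(4)
      unfolding G 2 robust_clique_complex_3 by simp
  qed
qed

end
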